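(* The Chern-Ricci flow does not preserve the $t$-Gauduchon Ricci-flat condition for $t<1$. That is: for every real $t<1$ there exist a compact complex manifold $(M,J)$ and a family of Hermitian metrics $\omega(s)$, $s\in[0,T)$, $T>0$, on $(M,J)$ solving the Chern-Ricci flow $$\frac{\partial}{\partial s}\omega(s)=-p(\omega(s),1),$$ such that $\omega(0)$ is $t$-Gauduchon Ricci-flat but $\omega(s)$ is not $t$-Gauduchon Ricci-flat for some $s\in(0,T)$.
   Context: For a Hermitian manifold $(M,g,J)$ the fundamental form is $\omega(X,Y)=g(JX,Y)$, and $\omega$ is also called the metric. The canonical (Gauduchon) connections $\nabla^t$, $t\in\mathbb{R}$, are given by $$g(\nabla^t_XY,Z)=g(\nabla^{LC}_XY,Z)+\tfrac{t-1}{4}d^c\omega(X,Y,Z)+\tfrac{t+1}{4}d^c\omega(X,JY,JZ),$$ with $\nabla^{LC}$ the Levi-Civita connection and $d^c\omega(X,Y,Z)=-d\omega(JX,JY,JZ)$; $\nabla^1$ is the Chern connection. Put $p(\omega,t)=\sqrt{-1}\,\mathrm{tr}(R(\nabla^t))$ (complex trace of the curvature), and let $p_1(\omega,t)=\frac12(p(\omega,t)+p(\omega,t)(J\cdot,J\cdot))$ be its $(1,1)$-part. $(M,\omega,J)$ is $t$-Gauduchon Ricci-flat if $p_1(\omega,t)=0$. *)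

theory Defs
  imports "HOL-Analysis.Analysis"
begin

text \<open>
  Tensor fields are families of components, one for each chart of an atlas. Complex
  coordinate space of dimension \<open>n\<close> is the set of sequences vanishing from index \<open>n\<close> on
  (the analogue of \<^const>\<open>Euclidean_space\<close>), so that \<open>n\<close> is an ordinary natural number.
  With $z_j = x_j + \sqrt{-1}\,y_j$, the $2n$ real coordinates are numbered from \<open>0\<close> as
  $x_0, y_0, x_1, y_1, \ldots$; thus $J\partial_{2j} = \partial_{2j+1}$ and
  $J\partial_{2j+1} = -\partial_{2j}$.
\<close>

type_synonym coords = "nat \<Rightarrow> complex"
type_synonym rvec = "nat \<Rightarrow> real"
type_synonym matrix_field = "coords \<Rightarrow> nat \<Rightarrow> nat \<Rightarrow> real"

definition Cspace :: "nat \<Rightarrow> coords set" where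
  "Cspace n = {z. \<forall>j\<ge>n. z j = 0}"

definition rcoord :: "nat \<Rightarrow> coords \<Rightarrow> real" where
  "rcoord k z = (if even k then Re (z (k div 2)) else Im (z (k div 2)))"

definition move :: "nat \<Rightarrow> real \<Rightarrow> coords \<Rightarrow> coords" where
  "move i s z = z(i div 2 := z (i div 2) + of_real s * (if even i then 1 else \<i>))"

definition pd :: "nat \<Rightarrow> (coords \<Rightarrow> real) \<Rightarrow> coords \<Rightarrow> real" where
  "pd i f z = deriv (\<lambda>s. f (move i s z)) 0"

definition smooth_fun :: "nat \<Rightarrow> coords set \<Rightarrow> (coords \<Rightarrow> real) \<Rightarrow> bool" where
  "smooth_fun n V f \<longleftrightarrow>
     (\<forall>ks. set ks \<subseteq> {..<2*n} \<longrightarrow>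
        continuous_on V (foldr pd ks f) \<and>
        (\<forall>z\<in>V. \<forall>i<2*n. (\<lambda>s. foldr pd ks f (move i s z)) differentiable (at 0)))"

text \<open>
  Joint smoothness on \<open>{0..<T} \<times> V\<close>: all iterated partial derivatives in time (\<^const>\<open>None\<close>)
  and space (\<^const>\<open>Some\<close>), in any order, exist and are jointly continuous; the time
  derivative at \<open>0\<close> is one-sided.
\<close>

definition pd_time :: "real \<Rightarrow> (real \<Rightarrow> coords \<Rightarrow> real) \<Rightarrow> real \<Rightarrow> coords \<Rightarrow> real" where
  "pd_time T f s z = vector_derivative (\<lambda>r. f r z) (at s within {0..<T})"

definition pd_spacetime ::
  "real \<Rightarrow> nat option \<Rightarrow> (real \<Rightarrow> coords \<Rightarrow> real) \<Rightarrow> real \<Rightarrow> coords \<Rightarrow> real" where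
  "pd_spacetime T d f =
     (case d of None \<Rightarrow> pd_time T f | Some i \<Rightarrow> (\<lambda>s. pd i (f s)))"

definition smooth_family ::
  "nat \<Rightarrow> real \<Rightarrow> coords set \<Rightarrow> (real \<Rightarrow> coords \<Rightarrow> real) \<Rightarrow> bool" where
  "smooth_family n T V f \<longleftrightarrow>
     (\<forall>ds. set ds \<subseteq> insert None (Some ` {..<2*n}) \<longrightarrow>
        (let h = foldr (pd_spacetime T) ds f in
           continuous_on ({0..<T} \<times> V) (\<lambda>(s, z). h s z) \<and>
           (\<forall>s\<in>{0..<T}. \<forall>z\<in>V.
              (\<lambda>r. h r z) differentiable (at s within {0..<T}) \<and>
              (\<forall>i<2*n. (\<lambda>r. h s (move i r z)) differentiable (at 0)))))"

text \<open>Holomorphy in several variables: continuous, and holomorphic in each variable separately.\<close>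

definition holo_map :: "nat \<Rightarrow> coords set \<Rightarrow> (coords \<Rightarrow> coords) \<Rightarrow> bool" where
  "holo_map n W F \<longleftrightarrow> continuous_on W F \<and>
     (\<forall>z\<in>W. \<forall>j<n. \<forall>k<n. (\<lambda>w. F (z(j := w)) k) field_differentiable (at (z j)))"


subsection \<open>Compact complex manifolds\<close>

text \<open>A chart is a pair of an open domain and a coordinate map on it.\<close>

type_synonym 'a chart = "'a set \<times> ('a \<Rightarrow> coords)"

definition chart_image :: "'a chart \<Rightarrow> coords set" where
  "chart_image c = snd c ` fst c"

definition overlap :: "'a chart \<Rightarrow> 'a chart \<Rightarrow> coords set" where
  "overlap c c' = snd c ` (fst c \<inter> fst c')"

definition transition :: "'a chart \<Rightarrow> 'a chart \<Rightarrow> coords \<Rightarrow> coords" where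
  "transition c c' = snd c' \<circ> inv_into (fst c) (snd c)"

definition complex_chart :: "nat \<Rightarrow> 'a topology \<Rightarrow> 'a chart \<Rightarrow> bool" where
  "complex_chart n X c \<longleftrightarrow>
     openin X (fst c) \<and> openin (top_of_set (Cspace n)) (chart_image c) \<and>
     homeomorphic_map (subtopology X (fst c)) (top_of_set (chart_image c)) (snd c)"

text \<open>
  Second countability follows from compactness. The atlas need not be maximal: tensor fields
  extend uniquely to all compatible charts. Compact manifolds embed in some complex coordinate
  space (Whitney), so quantifying over topologies on \<open>nat \<Rightarrow> complex\<close> reaches all of them up
  to isomorphism.
\<close>

definition compact_complex_manifold :: "nat \<Rightarrow> 'a topology \<Rightarrow> 'a chart set \<Rightarrow> bool" where
  "compact_complex_manifold n X A \<longleftrightarrow>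
     compact_space X \<and> Hausdorff_space X \<and>
     (\<forall>c\<in>A. complex_chart n X c) \<and> (\<Union>c\<in>A. fst c) = topspace X \<and>
     (\<forall>c\<in>A. \<forall>c'\<in>A. holo_map n (overlap c c') (transition c c'))"


subsection \<open>Hermitian metrics\<close>

definition bil :: "nat \<Rightarrow> (nat \<Rightarrow> nat \<Rightarrow> real) \<Rightarrow> rvec \<Rightarrow> rvec \<Rightarrow> real" where
  "bil n b X Y = (\<Sum>i<2*n. \<Sum>j<2*n. b i j * X i * Y j)"

definition ev :: "nat \<Rightarrow> rvec" where
  "ev i = (\<lambda>k. if k = i then 1 else 0)"

definition Jc :: "rvec \<Rightarrow> rvec" where
  "Jc X = (\<lambda>k. if even k then - X (k + 1) else X (k - 1))"

definition hermitian_form :: "nat \<Rightarrow> (nat \<Rightarrow> nat \<Rightarrow> real) \<Rightarrow> bool" where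
  "hermitian_form n b \<longleftrightarrow>
     (\<forall>i<2*n. \<forall>j<2*n. b i j = b j i) \<and>
     (\<forall>X. (\<exists>i<2*n. X i \<noteq> 0) \<longrightarrow> bil n b X X > 0) \<and>
     (\<forall>X Y. bil n b (Jc X) (Jc Y) = bil n b X Y)"

definition hermitian_metric ::
  "nat \<Rightarrow> 'a chart set \<Rightarrow> ('a chart \<Rightarrow> matrix_field) \<Rightarrow> bool" where
  "hermitian_metric n A g \<longleftrightarrow>
     (\<forall>c\<in>A. (\<forall>z\<in>chart_image c. hermitian_form n (g c z)) \<and>
        (\<forall>i<2*n. \<forall>j<2*n. smooth_fun n (chart_image c) (\<lambda>z. g c z i j))) \<and>
     (\<forall>c\<in>A. \<forall>c'\<in>A. \<forall>z\<in>overlap c c'. \<forall>i<2*n. \<forall>j<2*n.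
        g c z i j =
          (\<Sum>k<2*n. \<Sum>l<2*n.
             pd i (\<lambda>w. rcoord k (transition c c' w)) z *
             pd j (\<lambda>w. rcoord l (transition c c' w)) z *
             g c' (transition c c' z) k l))"


subsection \<open>Gauduchon connections in a chart\<close>

definition fundamental_form :: "nat \<Rightarrow> matrix_field \<Rightarrow> coords \<Rightarrow> rvec \<Rightarrow> rvec \<Rightarrow> real" where
  "fundamental_form n g z X Y = bil n (g z) (Jc X) Y"

text \<open>
  Exterior derivatives carry no factor $1/3$: on coordinate fields,
  $d\omega(X,Y,Z) = X\omega(Y,Z) + Y\omega(Z,X) + Z\omega(X,Y)$.
\<close>

definition d_fundamental ::
  "nat \<Rightarrow> matrix_field \<Rightarrow> coords \<Rightarrow> rvec \<Rightarrow> rvec \<Rightarrow> rvec \<Rightarrow> real" where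
  "d_fundamental n g z X Y Z =
     (\<Sum>i<2*n. \<Sum>j<2*n. \<Sum>k<2*n.
        (pd i (\<lambda>w. fundamental_form n g w (ev j) (ev k)) z +
         pd j (\<lambda>w. fundamental_form n g w (ev k) (ev i)) z +
         pd k (\<lambda>w. fundamental_form n g w (ev i) (ev j)) z) * X i * Y j * Z k)"

definition dc_fundamental ::
  "nat \<Rightarrow> matrix_field \<Rightarrow> coords \<Rightarrow> rvec \<Rightarrow> rvec \<Rightarrow> rvec \<Rightarrow> real" where
  "dc_fundamental n g z X Y Z = - d_fundamental n g z (Jc X) (Jc Y) (Jc Z)"

text \<open>$g(\nabla^{LC}_{\partial_i}\partial_j, \partial_k)$, by the Koszul formula.\<close>

definition levi_civita_low :: "matrix_field \<Rightarrow> coords \<Rightarrow> nat \<Rightarrow> nat \<Rightarrow> nat \<Rightarrow> real" where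
  "levi_civita_low g z i j k =
     (pd i (\<lambda>w. g w j k) z + pd j (\<lambda>w. g w i k) z - pd k (\<lambda>w. g w i j) z) / 2"

text \<open>$g(\nabla^t_{\partial_i}\partial_j, \partial_k)$.\<close>

definition gauduchon_low ::
  "nat \<Rightarrow> real \<Rightarrow> matrix_field \<Rightarrow> coords \<Rightarrow> nat \<Rightarrow> nat \<Rightarrow> nat \<Rightarrow> real" where
  "gauduchon_low n t g z i j k =
     levi_civita_low g z i j k
     + (t - 1) / 4 * dc_fundamental n g z (ev i) (ev j) (ev k)
     + (t + 1) / 4 * dc_fundamental n g z (ev i) (Jc (ev j)) (Jc (ev k))"

text \<open>
  The vector $\nabla^t_{\partial_i}\partial_j$ at \<open>z\<close>; existence and uniqueness hold because
  \<open>g z\<close> is nondegenerate.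
\<close>

definition gauduchon_conn ::
  "nat \<Rightarrow> real \<Rightarrow> matrix_field \<Rightarrow> nat \<Rightarrow> nat \<Rightarrow> coords \<Rightarrow> rvec" where
  "gauduchon_conn n t g i j z =
     (THE v. (\<forall>l\<ge>2*n. v l = 0) \<and>
             (\<forall>k<2*n. bil n (g z) v (ev k) = gauduchon_low n t g z i j k))"

text \<open>$\nabla^t_{\partial_i} Y$ for a vector field \<open>Y\<close>.\<close>

definition covariant_deriv ::
  "nat \<Rightarrow> real \<Rightarrow> matrix_field \<Rightarrow> nat \<Rightarrow> (coords \<Rightarrow> rvec) \<Rightarrow> coords \<Rightarrow> rvec" where
  "covariant_deriv n t g i Y z =
     (\<lambda>k. pd i (\<lambda>w. Y w k) z + (\<Sum>l<2*n. Y z l * gauduchon_conn n t g i l z k))"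

text \<open>
  $R(\partial_i,\partial_j)\partial_l = \nabla_{\partial_i}\nabla_{\partial_j}\partial_l -
  \nabla_{\partial_j}\nabla_{\partial_i}\partial_l$.
\<close>

definition curvature ::
  "nat \<Rightarrow> real \<Rightarrow> matrix_field \<Rightarrow> coords \<Rightarrow> nat \<Rightarrow> nat \<Rightarrow> nat \<Rightarrow> rvec" where
  "curvature n t g z i j l =
     (\<lambda>k. covariant_deriv n t g i (gauduchon_conn n t g j l) z k
        - covariant_deriv n t g j (gauduchon_conn n t g i l) z k)"

text \<open>
  Trace over \<open>\<complex>\<close> of a \<open>J\<close>-linear endomorphism \<open>E\<close>, given by the images \<open>E l\<close> of the real
  coordinate vectors, computed in the complex basis $\partial_0, \partial_2, \partial_4, \ldots$
  of the tangent space, on which $\sqrt{-1}$ acts as $J$.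
\<close>

definition complex_trace :: "nat \<Rightarrow> (nat \<Rightarrow> rvec) \<Rightarrow> complex" where
  "complex_trace n E = (\<Sum>j<n. Complex (E (2*j) (2*j)) (E (2*j) (2*j + 1)))"

text \<open>The form $p(\omega,t)$ and its $(1,1)$-part $p_1(\omega,t)$.\<close>

definition ricci_form ::
  "nat \<Rightarrow> real \<Rightarrow> matrix_field \<Rightarrow> coords \<Rightarrow> rvec \<Rightarrow> rvec \<Rightarrow> complex" where
  "ricci_form n t g z X Y =
     (\<Sum>i<2*n. \<Sum>j<2*n.
        \<i> * complex_trace n (curvature n t g z i j) * of_real (X i * Y j))"

definition ricci_form_11 ::
  "nat \<Rightarrow> real \<Rightarrow> matrix_field \<Rightarrow> coords \<Rightarrow> rvec \<Rightarrow> rvec \<Rightarrow> complex" where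
  "ricci_form_11 n t g z X Y =
     (ricci_form n t g z X Y + ricci_form n t g z (Jc X) (Jc Y)) / 2"

definition gauduchon_ricci_flat ::
  "nat \<Rightarrow> 'a chart set \<Rightarrow> real \<Rightarrow> ('a chart \<Rightarrow> matrix_field) \<Rightarrow> bool" where
  "gauduchon_ricci_flat n A t g \<longleftrightarrow>
     (\<forall>c\<in>A. \<forall>z\<in>chart_image c. \<forall>X Y. ricci_form_11 n t (g c) z X Y = 0)"


subsection \<open>The Chern-Ricci flow\<close>

text \<open>
  A solution on \<open>[0,T)\<close> is a family of metrics that is smooth in space and time together. The
  equation is between complex-valued forms; at \<open>s = 0\<close> the derivative is one-sided.
\<close>

definition chern_ricci_flow ::
  "nat \<Rightarrow> 'a chart set \<Rightarrow> real \<Rightarrow> (real \<Rightarrow> 'a chart \<Rightarrow> matrix_field) \<Rightarrow> bool" where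
  "chern_ricci_flow n A T g \<longleftrightarrow>
     (\<forall>s\<in>{0..<T}. hermitian_metric n A (g s)) \<and>
     (\<forall>c\<in>A. \<forall>i<2*n. \<forall>j<2*n.
        smooth_family n T (chart_image c) (\<lambda>s z. g s c z i j)) \<and>
     (\<forall>s\<in>{0..<T}. \<forall>c\<in>A. \<forall>z\<in>chart_image c. \<forall>X Y.
        ((\<lambda>r. complex_of_real (fundamental_form n (g r c) z X Y))
           has_vector_derivative - ricci_form n 1 (g s c) z X Y) (at s within {0..<T}))"

end

theory Submission
  imports Defs
begin

text \<open>
  On the Hopf surface $(\mathbb{C}^2 - 0)/(z \sim e^{2\pi} z)$ let $N = |z|^2$ and consider the
  metrics $\omega_{a,b} = a\,\omega_{1,0} + b\,\omega_{0,1}$, where $2\omega_{1,0} =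
  \sqrt{-1}\,\partial\bar\partial \log N$ is the transversal Fubini-Study part and
  $\omega_{0,1}$ is the part along the complex line through $z$. The complex trace of the
  connection form of $\nabla^t$ is a multiple of $\partial\log N$ plus an imaginary multiple of
  $d^c\log N$, which gives
  $p(\omega_{a,b}, t) = \bigl(4 - 2(1-t)\,b/a\bigr)\,\omega_{1,0}$.
  So $\omega_{a,b}$ is $t$-Gauduchon Ricci-flat iff $2a = (1-t)b$, which has a positive solution
  for every $t < 1$, while the Chern-Ricci flow decreases $a$ at rate $4$ and fixes $b$.
\<close>


subsection \<open>Rational functions on the punctured space\<close>

text \<open>A Kaehler metric would be of no use: there all canonical connections coincide, and a
  Ricci-flat metric is stationary for the flow. Here d\<omega> involves b alone, and the torsion
  enters the trace only through b/a. At t = 1 this term drops out: the determinant of the Hermitian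
  matrix is a constant multiple of 1/N^2 for all a and b, so the whole family has one Chern-Ricci
  form and the flow becomes an affine motion of a.

  Two features of the definitions shape the computation. Smoothness asks for all mixed iterated
  derivatives, which calls for a class of functions closed under differentiation. Partial
  derivatives are taken with the total function \<open>deriv\<close>, so a formula can be
  differentiated only if it holds on an open set of the sequence space. As for the quotient, the
  factor e^(2 pi) gives log|z| the period of an angle, and homogeneity of the metrics lets one
  formula represent them in every chart.\<close>

lemma rcoord_move: "rcoord k (move i r z) = rcoord k z + (if k = i then r else 0)"
proof (cases "k div 2 = i div 2")
  case True
  show ?thesis
  proof (cases "even k = even i")
    case True
    with \<open>k div 2 = i div 2\<close> have "k = i"
      by (metis dvd_mult_div_cancel odd_two_times_div_two_succ)
    then show ?thesis by (simp add: rcoord_def move_def)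
  next
    case False
    with True show ?thesis by (auto simp: rcoord_def move_def)
  qed
next
  case False
  then show ?thesis by (auto simp: rcoord_def move_def)
qed

lemma move_0 [simp]: "move i 0 z = z"
  by (simp add: move_def)

lemma continuous_on_move: "continuous_on UNIV (\<lambda>r. move i r z)"
proof (rule continuous_on_coordinatewise_then_product)
  fix k
  show "continuous_on UNIV (\<lambda>r. move i r z k)"
    by (cases "k = i div 2") (auto simp: move_def intro!: continuous_intros)
qed

lemma eventually_move_in:
  assumes "open U" "z \<in> U"
  shows "\<forall>\<^sub>F r in nhds 0. move i r z \<in> U"
proof -
  have "open ((\<lambda>r. move i r z) -` U)"
    using continuous_on_move[of i z] assms(1) by (simp add: continuous_on_open_vimage)
  moreover have "0 \<in> (\<lambda>r. move i r z) -` U" using assms(2) by simp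
  ultimately show ?thesis
    using eventually_nhds by (smt (verit) vimage_def mem_Collect_eq)
qed

lemma has_real_derivative_rcoord_move [derivative_intros]:
  "((\<lambda>r. rcoord k (move i r z)) has_real_derivative (if k = i then 1 else 0)) (at x)"
  by (auto simp: rcoord_move intro!: derivative_eq_intros)

lemma pd_eqI:
  "((\<lambda>r. f (move i r z)) has_real_derivative d) (at 0) \<Longrightarrow> pd i f z = d"
  by (simp add: pd_def DERIV_imp_deriv)

lemma pd_cong_open:
  assumes "open U" "z \<in> U" "\<And>w. w \<in> U \<Longrightarrow> f w = g w"
  shows "pd i f z = pd i g z"
  unfolding pd_def
  by (rule deriv_cong_ev) (auto intro: eventually_mono[OF eventually_move_in[OF assms(1,2)]] assms(3))

lemma continuous_on_rcoord [continuous_intros]: "continuous_on S (rcoord k)"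
  unfolding rcoord_def
  by (cases "even k") (auto intro!: continuous_intros continuous_on_subset[OF continuous_on_product_coordinates])

definition nsq :: "coords \<Rightarrow> real" where
  "nsq z = (\<Sum>k<4. (rcoord k z)\<^sup>2)"

lemma nsq_eq: "nsq z = (rcoord 0 z)\<^sup>2 + (rcoord 1 z)\<^sup>2 + (rcoord 2 z)\<^sup>2 + (rcoord 3 z)\<^sup>2"
  by (simp add: nsq_def eval_nat_numeral)

lemma nsq_cmod: "nsq z = (cmod (z 0))\<^sup>2 + (cmod (z 1))\<^sup>2"
  by (simp add: nsq_eq cmod_power2 rcoord_def)

lemma continuous_on_nsq [continuous_intros]: "continuous_on S nsq"
  unfolding nsq_def by (intro continuous_intros)

text \<open>Coordinates from index 2 on are left free, which makes the set open in the full sequence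
  space. Chart images lie in \<open>Cspace 2\<close> and are not open there, so formulas are
  differentiated on this larger set.\<close>

definition punctured :: "coords set" where
  "punctured = {z. nsq z > 0}"

lemma open_punctured: "open punctured"
  unfolding punctured_def by (intro open_Collect_less continuous_intros)

lemma has_real_derivative_nsq_move [derivative_intros]:
  assumes "i < 4"
  shows "((\<lambda>r. nsq (move i r z)) has_real_derivative 2 * rcoord i (move i x z)) (at x)"
proof -
  have "((\<lambda>r. nsq (move i r z)) has_real_derivative
      (\<Sum>k<4. 2 * rcoord k (move i x z) * (if k = i then 1 else 0))) (at x)"
    unfolding nsq_def by (auto intro!: derivative_eq_intros sum.cong)
  also have "(\<Sum>k<4. 2 * rcoord k (move i x z) * (if k = i then 1 else 0)) = 2 * rcoord i (move i x z)"
    using assms by (simp add: if_distrib cong: if_cong)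
  finally show ?thesis .
qed

text \<open>Polynomials in time, the real coordinates and 1/N. Since the derivative of 1/N is -2
  x_i/N^2, the class is closed under derivatives in space as well as in time.\<close>

inductive rational_family :: "(real \<Rightarrow> coords \<Rightarrow> real) \<Rightarrow> bool" where
  const: "rational_family (\<lambda>_ _. c)"
| time: "rational_family (\<lambda>s _. s)"
| coord: "rational_family (\<lambda>_. rcoord k)"
| inv: "rational_family (\<lambda>_ z. inverse (nsq z))"
| add: "rational_family f \<Longrightarrow> rational_family g \<Longrightarrow> rational_family (\<lambda>s z. f s z + g s z)"
| mult: "rational_family f \<Longrightarrow> rational_family g \<Longrightarrow> rational_family (\<lambda>s z. f s z * g s z)"

lemma rational_family_uminus: "rational_family f \<Longrightarrow> rational_family (\<lambda>s z. - f s z)"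
  using mult[OF const[of "-1"]] by simp

lemma rational_family_diff:
  "rational_family f \<Longrightarrow> rational_family g \<Longrightarrow> rational_family (\<lambda>s z. f s z - g s z)"
  using add[OF _ rational_family_uminus] by simp

lemma rational_family_power: "rational_family f \<Longrightarrow> rational_family (\<lambda>s z. f s z ^ k)"
  by (induction k) (auto intro: const mult)

lemma rational_family_divide: "rational_family f \<Longrightarrow> rational_family (\<lambda>s z. f s z / c)"
  using mult[OF const[of "inverse c"]] by (simp add: field_simps)

lemma rational_family_divide_nsq: "rational_family f \<Longrightarrow> rational_family (\<lambda>s z. f s z / nsq z ^ k)"
  using mult[OF _ rational_family_power[OF inv]] by (simp add: divide_inverse power_inverse)

lemma rational_family_sum:
  "(\<And>k. k \<in> K \<Longrightarrow> rational_family (f k)) \<Longrightarrow> rational_family (\<lambda>s z. \<Sum>k\<in>K. f k s z)"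
proof (induction K rule: infinite_finite_induct)
  case (insert k K)
  then show ?case using add[of "f k" "\<lambda>s z. \<Sum>k\<in>K. f k s z"] by simp
qed (auto intro: const)

lemma rational_family_if:
  "rational_family f \<Longrightarrow> rational_family g \<Longrightarrow> rational_family (\<lambda>s z. if P then f s z else g s z)"
  by (cases P) auto

lemmas rational_family_intros =
  const time coord add mult rational_family_uminus rational_family_diff rational_family_power
  rational_family_divide rational_family_divide_nsq rational_family_sum rational_family_if

lemma rational_family_space_derivative:
  assumes "rational_family h" "i < 4"
  shows "\<exists>h'. rational_family h' \<and> (\<forall>s. \<forall>z\<in>punctured.
           ((\<lambda>r. h s (move i r z)) has_real_derivative h' s z) (at 0))"
  using assms(1)
proof induction
  case (const c)
  then show ?case by (intro exI[of _ "\<lambda>_ _. 0"]) (auto intro: rational_family.intros)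
next
  case time
  then show ?case by (intro exI[of _ "\<lambda>_ _. 0"]) (auto intro: rational_family.intros)
next
  case (coord k)
  then show ?case
    by (intro exI[of _ "\<lambda>_ _. if k = i then 1 else 0"] conjI allI ballI
        has_real_derivative_rcoord_move rational_family.const)
next
  case inv
  show ?case
  proof (intro exI[of _ "\<lambda>_ z. - (2 * rcoord i z / nsq z ^ 2)"] conjI allI ballI)
    show "rational_family (\<lambda>_ z. - (2 * rcoord i z / nsq z ^ 2))"
      by (intro rational_family_intros)
    fix s :: real and z assume "z \<in> punctured"
    then show "((\<lambda>r. inverse (nsq (move i r z))) has_real_derivative - (2 * rcoord i z / nsq z ^ 2)) (at 0)"
      using assms(2) by (auto intro!: derivative_eq_intros simp: punctured_def power2_eq_square divide_simps)
  qed
next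
  case (add f g)
  then obtain f' g' where *: "rational_family f'" "rational_family g'"
    "\<forall>s. \<forall>z\<in>punctured. ((\<lambda>r. f s (move i r z)) has_real_derivative f' s z) (at 0)"
    "\<forall>s. \<forall>z\<in>punctured. ((\<lambda>r. g s (move i r z)) has_real_derivative g' s z) (at 0)" by blast
  show ?case
    by (rule exI[of _ "\<lambda>s z. f' s z + g' s z"]) (use * in \<open>auto intro!: rational_family.add derivative_eq_intros\<close>)
next
  case (mult f g)
  then obtain f' g' where *: "rational_family f'" "rational_family g'"
    "\<forall>s. \<forall>z\<in>punctured. ((\<lambda>r. f s (move i r z)) has_real_derivative f' s z) (at 0)"
    "\<forall>s. \<forall>z\<in>punctured. ((\<lambda>r. g s (move i r z)) has_real_derivative g' s z) (at 0)" by blast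
  show ?case
  proof (rule exI[of _ "\<lambda>s z. f' s z * g s z + g' s z * f s z"], intro conjI allI ballI)
    show "rational_family (\<lambda>s z. f' s z * g s z + g' s z * f s z)"
      using * mult.hyps by (intro rational_family.intros)
    fix s z assume "z \<in> punctured"
    with * show "((\<lambda>r. f s (move i r z) * g s (move i r z)) has_real_derivative
        f' s z * g s z + g' s z * f s z) (at 0)"
      using DERIV_mult[of "\<lambda>r. f s (move i r z)" "f' s z" 0 UNIV "\<lambda>r. g s (move i r z)" "g' s z"] by simp
  qed
qed

text \<open>Time enters polynomially, so the derivative exists along any set S; with
  \<open>S = {0..<T}\<close> this covers the one-sided derivative at 0.\<close>

lemma rational_family_time_derivative:
  assumes "rational_family h"
  shows "\<exists>h'. rational_family h' \<and>
           (\<forall>s z S. ((\<lambda>r. h r z) has_real_derivative h' s z) (at s within S))"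
  using assms
proof induction
  case time
  then show ?case by (intro exI[of _ "\<lambda>_ _. 1"]) (auto intro: rational_family.intros)
next
  case (add f g)
  then obtain f' g' where *: "rational_family f'" "rational_family g'"
    "\<forall>s z S. ((\<lambda>r. f r z) has_real_derivative f' s z) (at s within S)"
    "\<forall>s z S. ((\<lambda>r. g r z) has_real_derivative g' s z) (at s within S)" by blast
  show ?case
    by (rule exI[of _ "\<lambda>s z. f' s z + g' s z"]) (use * in \<open>auto intro!: rational_family.add derivative_eq_intros\<close>)
next
  case (mult f g)
  then obtain f' g' where *: "rational_family f'" "rational_family g'"
    "\<forall>s z S. ((\<lambda>r. f r z) has_real_derivative f' s z) (at s within S)"
    "\<forall>s z S. ((\<lambda>r. g r z) has_real_derivative g' s z) (at s within S)" by blast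
  show ?case
    by (rule exI[of _ "\<lambda>s z. f' s z * g s z + g' s z * f s z"])
       (use * mult.hyps in \<open>auto intro!: rational_family.intros DERIV_mult\<close>)
qed (auto intro!: exI[of _ "\<lambda>_ _. 0"] intro: rational_family.intros)

lemma rational_family_continuous:
  "rational_family h \<Longrightarrow> continuous_on (UNIV \<times> punctured) (\<lambda>(s, z). h s z)"
proof (induction rule: rational_family.induct)
  case (coord k)
  show ?case unfolding case_prod_unfold
    by (rule continuous_on_compose2[OF continuous_on_rcoord[of UNIV] continuous_on_snd[OF continuous_on_id]]) auto
next
  case inv
  have "continuous_on (UNIV \<times> punctured) (\<lambda>p. nsq (snd p))"
    by (rule continuous_on_compose2[OF continuous_on_nsq[of UNIV] continuous_on_snd[OF continuous_on_id]]) auto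
  then show ?case unfolding case_prod_unfold
    by (intro continuous_on_inverse) (auto simp: punctured_def)
qed (auto simp: case_prod_unfold intro!: continuous_intros)

text \<open>Agreement on \<open>{0..<T}\<close> times \<open>punctured\<close> is enough to continue
  the induction: time derivatives are taken within \<open>{0..<T}\<close>, and space derivatives see
  only a neighbourhood inside the open set \<open>punctured\<close>.\<close>

lemma rational_family_iterated_derivative:
  assumes "rational_family h" "T > 0" "set ds \<subseteq> insert None (Some ` {..<4})"
  shows "\<exists>h'. rational_family h' \<and>
           (\<forall>s\<in>{0..<T}. \<forall>z\<in>punctured. foldr (pd_spacetime T) ds h s z = h' s z)"
  using assms(3)
proof (induction ds)
  case Nil
  then show ?case using assms(1) by auto
next
  case (Cons d ds)
  then obtain f where f: "rational_family f"
    "\<And>s z. s \<in> {0..<T} \<Longrightarrow> z \<in> punctured \<Longrightarrow> foldr (pd_spacetime T) ds h s z = f s z" by auto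
  show ?case
  proof (cases d)
    case None
    obtain f' where f': "rational_family f'"
      "\<And>s z S. ((\<lambda>r. f r z) has_real_derivative f' s z) (at s within S)"
      using rational_family_time_derivative[OF f(1)] by blast
    have "foldr (pd_spacetime T) (d # ds) h s z = f' s z" if "s \<in> {0..<T}" "z \<in> punctured" for s z
    proof -
      have "((\<lambda>r. foldr (pd_spacetime T) ds h r z) has_vector_derivative f' s z) (at s within {0..<T})"
        using f'(2)[of z s "{0..<T}"] that f(2)
        by (auto simp: has_real_derivative_iff_has_vector_derivative intro: has_vector_derivative_transform)
      \<comment> \<open>Uniqueness of the one-sided derivative: the interval accumulates at each of
        its points, including 0, because T > 0.\<close>
      moreover have "at s within {0..<T} \<noteq> bot"
        using that assms(2) by (auto simp: trivial_limit_within islimpt_Ico)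
      ultimately show ?thesis
        by (simp add: None pd_spacetime_def pd_time_def vector_derivative_within)
    qed
    with f' show ?thesis by blast
  next
    case (Some i)
    with Cons.prems have "i < 4" by auto
    from rational_family_space_derivative[OF f(1) this] obtain f' where f': "rational_family f'"
      "\<And>s z. z \<in> punctured \<Longrightarrow> ((\<lambda>r. f s (move i r z)) has_real_derivative f' s z) (at 0)"
      by blast
    have "foldr (pd_spacetime T) (d # ds) h s z = f' s z" if "s \<in> {0..<T}" "z \<in> punctured" for s z
    proof -
      have "foldr (pd_spacetime T) (d # ds) h s z = pd i (f s) z"
        using that f(2) by (auto simp: Some pd_spacetime_def intro!: pd_cong_open[OF open_punctured])
      then show ?thesis using f'(2)[OF that(2)] by (simp add: pd_eqI)
    qed
    with f' show ?thesis by blast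
  qed
qed

lemma smooth_family_rational_family:
  assumes "rational_family h" "T > 0" "V \<subseteq> punctured"
  shows "smooth_family 2 T V h"
  unfolding smooth_family_def Let_def
proof (intro allI impI)
  fix ds :: "nat option list" assume "set ds \<subseteq> insert None (Some ` {..<2*2})"
  then have "set ds \<subseteq> insert None (Some ` {..<4})" by simp
  from rational_family_iterated_derivative[OF assms(1,2) this] obtain f where f: "rational_family f"
    and eq: "\<And>s z. s \<in> {0..<T} \<Longrightarrow> z \<in> punctured \<Longrightarrow> foldr (pd_spacetime T) ds h s z = f s z" by blast
  have "continuous_on ({0..<T} \<times> V) (\<lambda>(s, z). f s z)"
    using rational_family_continuous[OF f] by (rule continuous_on_subset) (use assms(3) in auto)
  then have 1: "continuous_on ({0..<T} \<times> V) (\<lambda>(s, z). foldr (pd_spacetime T) ds h s z)"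
    using assms(3) by (subst continuous_on_cong[OF refl, where g = "\<lambda>(s, z). f s z"]) (auto intro!: eq)
  have 2: "(\<lambda>r. foldr (pd_spacetime T) ds h r z) differentiable (at s within {0..<T})"
    if "s \<in> {0..<T}" "z \<in> V" for s z
  proof -
    obtain d where "((\<lambda>r. f r z) has_real_derivative d) (at s within {0..<T})"
      using rational_family_time_derivative[OF f] by blast
    then have "((\<lambda>r. foldr (pd_spacetime T) ds h r z) has_real_derivative d) (at s within {0..<T})"
      by (rule has_field_derivative_transform_within[of _ _ _ _ 1]) (use that assms(3) in \<open>auto simp: eq\<close>)
    then show ?thesis by (auto simp: real_differentiable_def)
  qed
  have 3: "(\<lambda>r. foldr (pd_spacetime T) ds h s (move i r z)) differentiable (at 0)"
    if "s \<in> {0..<T}" "z \<in> V" "i < 2*2" for s z i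
  proof -
    have z: "z \<in> punctured" using that assms by auto
    then obtain d where "((\<lambda>r. f s (move i r z)) has_real_derivative d) (at 0)"
      using rational_family_space_derivative[OF f, of i] \<open>i < 2*2\<close> by auto
    moreover have "\<forall>\<^sub>F r in nhds 0. f s (move i r z) = foldr (pd_spacetime T) ds h s (move i r z)"
      using eventually_move_in[OF open_punctured z, of i]
      by eventually_elim (use that in \<open>auto simp: eq\<close>)
    ultimately have "((\<lambda>r. foldr (pd_spacetime T) ds h s (move i r z)) has_real_derivative d) (at 0)"
      by (rule DERIV_cong_ev[OF refl _ refl, THEN iffD1, rotated])
    then show ?thesis by (auto simp: real_differentiable_def)
  qed
  show "continuous_on ({0..<T} \<times> V) (\<lambda>(s, z). foldr (pd_spacetime T) ds h s z) \<and>
           (\<forall>s\<in>{0..<T}. \<forall>z\<in>V.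
              (\<lambda>r. foldr (pd_spacetime T) ds h r z) differentiable (at s within {0..<T}) \<and>
              (\<forall>i<2*2. (\<lambda>r. foldr (pd_spacetime T) ds h s (move i r z)) differentiable (at 0)))"
    using 1 2 3 by blast
qed

text \<open>A list of purely spatial derivatives is a space-time list without \<open>None\<close>,
  so smoothness of each single metric follows from that of the family.\<close>

lemma smooth_fun_slice:
  assumes "smooth_family n T V f" "s \<in> {0..<T}"
  shows "smooth_fun n V (f s)"
  unfolding smooth_fun_def
proof (intro allI impI)
  fix ks :: "nat list" assume ks: "set ks \<subseteq> {..<2*n}"
  have eq: "foldr (pd_spacetime T) (map Some ks) f s = foldr pd ks (f s)"
    by (induction ks) (auto simp: pd_spacetime_def)
  have "set (map Some ks) \<subseteq> insert None (Some ` {..<2*n})" using ks by auto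
  with assms(1)[unfolded smooth_family_def Let_def] have
    c: "continuous_on ({0..<T} \<times> V) (\<lambda>(s, z). foldr (pd_spacetime T) (map Some ks) f s z)" and
    d: "\<forall>z\<in>V. \<forall>i<2*n. (\<lambda>r. foldr (pd_spacetime T) (map Some ks) f s (move i r z)) differentiable (at 0)"
    using assms(2) by blast+
  have "continuous_on V ((\<lambda>(s, z). foldr (pd_spacetime T) (map Some ks) f s z) \<circ> Pair s)"
    by (rule continuous_on_compose) (use assms(2) in \<open>auto intro!: continuous_intros continuous_on_subset[OF c]\<close>)
  then have "continuous_on V (foldr pd ks (f s))"
    by (simp add: o_def eq)
  with d show "continuous_on V (foldr pd ks (f s)) \<and>
        (\<forall>z\<in>V. \<forall>i<2*n. (\<lambda>r. foldr pd ks (f s) (move i r z)) differentiable (at 0))"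
    by (simp add: eq)
qed


subsection \<open>The metrics and their canonical connections\<close>

lemma sum_lessThan_4: "(\<Sum>i<4. f i) = f 0 + f 1 + f 2 + f (3::nat)" for f :: "nat \<Rightarrow> 'a::comm_monoid_add"
  by (simp add: eval_nat_numeral ac_simps)

lemma less_4_cases: "i < 4 \<Longrightarrow> i = 0 \<or> i = 1 \<or> i = 2 \<or> i = (3::nat)"
  by linarith

definition flipJ :: "nat \<Rightarrow> nat" where
  "flipJ i = (if even i then i + 1 else i - 1)"

definition sgnJ :: "nat \<Rightarrow> real" where
  "sgnJ i = (if even i then 1 else - 1)"

lemma Jc_ev: "Jc (ev i) = (\<lambda>k. sgnJ i * ev (flipJ i) k)"
  unfolding Jc_def ev_def flipJ_def sgnJ_def fun_eq_iff by (auto; presburger)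

lemma Jc_Jc_ev: "Jc (Jc (ev i)) = (\<lambda>k. - ev i k)"
  by (auto simp: Jc_def ev_def fun_eq_iff)

lemma flipJ_less: "i < 2 * n \<Longrightarrow> flipJ i < 2 * n"
  by (auto simp: flipJ_def elim!: evenE)

lemma sum_ev:
  assumes "i < n"
  shows "(\<Sum>k<n. F k * ev i k) = F i"
proof -
  have "(\<Sum>k<n. F k * ev i k) = (\<Sum>k<n. if k = i then F k else 0)"
    by (intro sum.cong) (auto simp: ev_def)
  with assms show ?thesis by simp
qed

lemma bil_ev_right: "k < 2*n \<Longrightarrow> bil n b v (ev k) = (\<Sum>m<2*n. b m k * v m)"
  unfolding bil_def by (intro sum.cong refl sum_ev)

lemma bil_ev: "i < 2*n \<Longrightarrow> j < 2*n \<Longrightarrow> bil n b (\<lambda>k. c * ev i k) (ev j) = c * b i j"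
  using sum_ev[of i "2*n" "\<lambda>m. c * b m j"] by (simp add: bil_ev_right ac_simps)

lemma fundamental_form_ev:
  "j < 2*n \<Longrightarrow> k < 2*n \<Longrightarrow> fundamental_form n g w (ev j) (ev k) = sgnJ j * g w (flipJ j) k"
  by (simp add: fundamental_form_def Jc_ev bil_ev flipJ_less)

lemma d_fundamental_ev:
  assumes "i < 2*n" "j < 2*n" "k < 2*n"
  shows "d_fundamental n g z (\<lambda>m. a * ev i m) (\<lambda>m. b * ev j m) (\<lambda>m. c * ev k m) =
    a * b * c * (pd i (\<lambda>w. fundamental_form n g w (ev j) (ev k)) z +
         pd j (\<lambda>w. fundamental_form n g w (ev k) (ev i)) z +
         pd k (\<lambda>w. fundamental_form n g w (ev i) (ev j)) z)"
proof -
  have *: "(\<Sum>m<2*n. F m * (c * ev k m)) = F k * c" if "k < 2*n" for F c k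
    using sum_ev[OF that, of "\<lambda>m. F m * c"] by (simp add: mult.assoc)
  show ?thesis
    unfolding d_fundamental_def *[OF assms(3)]
    unfolding sum_distrib_right[symmetric] *[OF assms(2)] *[OF assms(1)]
    by (simp add: ac_simps)
qed

text \<open>The difference of two solutions pairs to zero with all coordinate vectors, hence with
  itself, and positive definiteness makes it vanish below 2n; above, both are zero by the padding
  convention.\<close>

lemma gauduchon_conn_eqI:
  assumes "hermitian_form n (g z)" "\<And>l. l \<ge> 2*n \<Longrightarrow> v l = 0"
    "\<And>k. k < 2*n \<Longrightarrow> bil n (g z) v (ev k) = gauduchon_low n t g z i j k"
  shows "gauduchon_conn n t g i j z = v"
  unfolding gauduchon_conn_def
proof (rule the_equality)
  fix w assume w: "(\<forall>l\<ge>2*n. w l = 0) \<and> (\<forall>k<2*n. bil n (g z) w (ev k) = gauduchon_low n t g z i j k)"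
  define d where "d = (\<lambda>k. w k - v k)"
  have "bil n (g z) d (ev k) = 0" if "k < 2*n" for k
    using assms(3)[OF that] w that by (simp add: bil_ev_right d_def algebra_simps sum_subtractf)
  then have "(\<Sum>k<2*n. d k * bil n (g z) d (ev k)) = 0" by simp
  also have "(\<Sum>k<2*n. d k * bil n (g z) d (ev k)) = (\<Sum>k<2*n. \<Sum>m<2*n. g z m k * d m * d k)"
    by (simp add: bil_ev_right sum_distrib_left mult_ac)
  also have "\<dots> = bil n (g z) d d" unfolding bil_def by (rule sum.swap)
  finally have "\<forall>k<2*n. d k = 0" using assms(1) by (force simp: hermitian_form_def)
  then show "w = v" using w assms(2) unfolding d_def fun_eq_iff by (metis eq_iff_diff_eq_0 not_less)
qed (use assms in auto)

section \<open>The metrics, their Levi-Civita coefficients and d\<omega>\<close>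

definition jcoord :: "nat \<Rightarrow> coords \<Rightarrow> real" where
  "jcoord k z = Jc (\<lambda>m. rcoord m z) k"

lemma jcoord_move: "jcoord k (move i r z) = jcoord k z + Jc (ev i) k * r"
  by (auto simp: jcoord_def Jc_def ev_def rcoord_move)

definition kd :: "nat \<Rightarrow> nat \<Rightarrow> real" where
  "kd i j = (if i = j then 1 else 0)"

text \<open>The position vector (\<open>rcoord\<close>) and its image under J
  (\<open>jcoord\<close>) span the complex line through z. The metric is b/N on that line and a/N on
  its Euclidean complement; a = 1, b = 0 gives the degenerate form \<omega>_{1,0} of the
  overview.\<close>

definition hopf_metric :: "real \<Rightarrow> real \<Rightarrow> matrix_field" where
  "hopf_metric a b z i j =
     a * inverse (nsq z) * kd i j
     + (b - a) * (inverse (nsq z))\<^sup>2 * (rcoord i z * rcoord j z + jcoord i z * jcoord j z)"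

lemma has_real_derivative_jcoord_move [derivative_intros]:
  "((\<lambda>r. jcoord k (move i r z)) has_real_derivative Jc (ev i) k) (at x)"
  by (auto simp: jcoord_move intro!: derivative_eq_intros)

lemma has_real_derivative_inverse_nsq_move:
  assumes "i < 4" "z \<in> punctured"
  shows "((\<lambda>r. inverse (nsq (move i r z))) has_real_derivative
     - (2 * rcoord i z * (inverse (nsq z))\<^sup>2)) (at 0)"
  using assms by (auto intro!: derivative_eq_intros simp: punctured_def power2_eq_square divide_simps)

lemma has_real_derivative_hopf_metric_move:
  assumes "i < 4" "z \<in> punctured"
  shows "((\<lambda>r. hopf_metric a b (move i r z) j k) has_real_derivative
     - 2 * a * (inverse (nsq z))\<^sup>2 * rcoord i z * kd j k
     + (b - a) * (inverse (nsq z))\<^sup>2 *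
        (kd i j * rcoord k z + rcoord j z * kd i k + Jc (ev i) j * jcoord k z + jcoord j z * Jc (ev i) k)
     - 4 * (b - a) * (inverse (nsq z))^3 * rcoord i z * (rcoord j z * rcoord k z + jcoord j z * jcoord k z))
     (at 0)"
  unfolding hopf_metric_def
  by (rule derivative_eq_intros has_real_derivative_inverse_nsq_move[OF assms] refl)+
     (simp add: kd_def power2_eq_square power3_eq_cube algebra_simps)

lemma pd_hopf_metric:
  assumes "i < 4" "z \<in> punctured"
  shows "pd i (\<lambda>w. hopf_metric a b w j k) z =
     - 2 * a * (inverse (nsq z))\<^sup>2 * rcoord i z * kd j k
     + (b - a) * (inverse (nsq z))\<^sup>2 *
        (kd i j * rcoord k z + rcoord j z * kd i k + Jc (ev i) j * jcoord k z + jcoord j z * Jc (ev i) k)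
     - 4 * (b - a) * (inverse (nsq z))^3 * rcoord i z * (rcoord j z * rcoord k z + jcoord j z * jcoord k z)"
  by (rule pd_eqI[OF has_real_derivative_hopf_metric_move[OF assms]])

lemma Jc_ev_antisym: "Jc (ev j) i = - Jc (ev i) j"
  unfolding Jc_def ev_def by (auto; presburger)

lemma levi_civita_low_hopf:
  assumes "i < 4" "j < 4" "k < 4" "z \<in> punctured"
  shows "levi_civita_low (hopf_metric a b) z i j k =
    - a * (inverse (nsq z))\<^sup>2 * (rcoord i z * kd j k + rcoord j z * kd i k - rcoord k z * kd i j)
    + (b - a) * (inverse (nsq z))\<^sup>2 * (kd i j * rcoord k z + jcoord j z * Jc (ev i) k + jcoord i z * Jc (ev j) k)
    - 2 * (b - a) * (inverse (nsq z))^3 *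
      (rcoord i z * (rcoord j z * rcoord k z + jcoord j z * jcoord k z)
       + rcoord j z * (rcoord i z * rcoord k z + jcoord i z * jcoord k z)
       - rcoord k z * (rcoord i z * rcoord j z + jcoord i z * jcoord j z))"
proof -
  define u where "u = inverse (nsq z)"
  have kd: "kd j i = kd i j" "kd k i = kd i k" "kd k j = kd j k" by (auto simp: kd_def)
  have J: "Jc (ev j) i = - Jc (ev i) j" "Jc (ev k) i = - Jc (ev i) k" "Jc (ev k) j = - Jc (ev j) k"
    by (rule Jc_ev_antisym)+
  show ?thesis
    unfolding levi_civita_low_def pd_hopf_metric[OF assms(1,4)] pd_hopf_metric[OF assms(2,4)]
      pd_hopf_metric[OF assms(3,4)] kd J u_def[symmetric]
    by (subst nonzero_divide_eq_eq, simp) algebra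
qed

lemma punctured_inverse_nsq:
  "z \<in> punctured \<Longrightarrow>
    inverse (nsq z) * ((rcoord 0 z)\<^sup>2 + (rcoord 1 z)\<^sup>2 + (rcoord 2 z)\<^sup>2 + (rcoord 3 z)\<^sup>2) = 1"
  by (simp add: punctured_def flip: nsq_eq del: One_nat_def)

text \<open>The left sides are Euclidean products with J applied to the i-th coordinate vector. As J
  is skew and orthogonal, it moves onto the position vector with a sign, or cancels.\<close>

lemma jcoord_flipJ:
  "sgnJ i * rcoord (flipJ i) z = - jcoord i z" "sgnJ i * jcoord (flipJ i) z = rcoord i z"
  by (auto simp: sgnJ_def flipJ_def jcoord_def Jc_def elim!: oddE)

lemma kd_flipJ: "sgnJ i * kd (flipJ i) j = Jc (ev i) j"
  unfolding Jc_ev by (simp add: ev_def kd_def)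

lemma Jc_ev_flipJ:
  "sgnJ i * Jc (ev (flipJ i)) j = - kd i j" "sgnJ i * Jc (ev j) (flipJ i) = kd i j"
  unfolding sgnJ_def flipJ_def Jc_def ev_def kd_def by (auto; presburger)+

lemma fundamental_form_hopf_ev:
  assumes "j < 4" "k < 4"
  shows "fundamental_form 2 (hopf_metric a b) z (ev j) (ev k) =
    a * inverse (nsq z) * Jc (ev j) k
    + (b - a) * (inverse (nsq z))\<^sup>2 * (rcoord j z * jcoord k z - jcoord j z * rcoord k z)"
proof -
  have "fundamental_form 2 (hopf_metric a b) z (ev j) (ev k) =
    a * inverse (nsq z) * (sgnJ j * kd (flipJ j) k)
    + (b - a) * (inverse (nsq z))\<^sup>2 *
      ((sgnJ j * jcoord (flipJ j) z) * jcoord k z + (sgnJ j * rcoord (flipJ j) z) * rcoord k z)"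
    using assms by (simp only: fundamental_form_ev hopf_metric_def) (simp add: algebra_simps)
  then show ?thesis by (simp only: jcoord_flipJ kd_flipJ) simp
qed

lemma pd_fundamental_form_hopf_ev:
  assumes "i < 4" "j < 4" "k < 4" "z \<in> punctured"
  shows "pd i (\<lambda>w. fundamental_form 2 (hopf_metric a b) w (ev j) (ev k)) z =
    - 2 * a * (inverse (nsq z))\<^sup>2 * rcoord i z * Jc (ev j) k
    + (b - a) * (inverse (nsq z))\<^sup>2 *
       (kd i j * jcoord k z + rcoord j z * Jc (ev i) k - Jc (ev i) j * rcoord k z - jcoord j z * kd i k)
    - 4 * (b - a) * (inverse (nsq z))^3 * rcoord i z * (rcoord j z * jcoord k z - jcoord j z * rcoord k z)"
  unfolding fundamental_form_hopf_ev[OF assms(2,3)]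
  by (rule pd_eqI, (rule derivative_eq_intros has_real_derivative_inverse_nsq_move[OF assms(1,4)] refl)+)
     (simp add: kd_def power2_eq_square power3_eq_cube algebra_simps)

lemma kd_sym: "kd j i = kd i j"
  by (auto simp: kd_def)

text \<open>The transversal part \<omega>_{1,0} is closed, so d\<omega> is that of b \<omega>_0/N
  with \<omega>_0 the flat form; this is why a disappears. The result is -b dN/N^2 wedge \<omega>_0
  in components.\<close>

lemma d_fundamental_hopf_ev:
  assumes "i < 4" "j < 4" "k < 4" "z \<in> punctured"
  shows "d_fundamental 2 (hopf_metric a b) z (\<lambda>m. c * ev i m) (\<lambda>m. d * ev j m) (\<lambda>m. e * ev k m) =
    - 2 * b * (inverse (nsq z))\<^sup>2 * c * d * e *
      (rcoord i z * Jc (ev j) k + rcoord j z * Jc (ev k) i + rcoord k z * Jc (ev i) j)"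
proof -
  have kd: "kd j i = kd i j" "kd k i = kd i k" "kd k j = kd j k" by (rule kd_sym)+
  have J: "Jc (ev j) i = - Jc (ev i) j" "Jc (ev k) i = - Jc (ev i) k" "Jc (ev k) j = - Jc (ev j) k"
    by (rule Jc_ev_antisym)+
  show ?thesis
    using assms by (simp only: d_fundamental_ev pd_fundamental_form_hopf_ev kd J) algebra
qed

lemma dc_fundamental_hopf_ev:
  assumes "i < 4" "j < 4" "k < 4" "z \<in> punctured"
  shows "dc_fundamental 2 (hopf_metric a b) z (ev i) (ev j) (ev k) =
    - 2 * b * (inverse (nsq z))\<^sup>2 *
      (jcoord i z * Jc (ev j) k + jcoord j z * Jc (ev k) i + jcoord k z * Jc (ev i) j)"
proof -
  have f: "flipJ i < 4" "flipJ j < 4" "flipJ k < 4"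
    using flipJ_less[of _ 2] assms by auto
  \<comment> \<open>Invariance of the flat fundamental form under J in both arguments.\<close>
  have 1: "sgnJ j * sgnJ k * Jc (ev (flipJ j)) (flipJ k) = Jc (ev j) k" for j k
  proof -
    have "sgnJ k * (sgnJ j * Jc (ev (flipJ j)) (flipJ k)) = - (sgnJ k * kd (flipJ k) j)"
      by (simp only: Jc_ev_flipJ kd_sym[of "flipJ k"])
    then show ?thesis by (simp add: kd_flipJ Jc_ev_antisym[of k j] mult_ac)
  qed
  have "dc_fundamental 2 (hopf_metric a b) z (ev i) (ev j) (ev k) =
    2 * b * (inverse (nsq z))\<^sup>2 *
      ((sgnJ i * rcoord (flipJ i) z) * (sgnJ j * sgnJ k * Jc (ev (flipJ j)) (flipJ k))
       + (sgnJ j * rcoord (flipJ j) z) * (sgnJ k * sgnJ i * Jc (ev (flipJ k)) (flipJ i))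
       + (sgnJ k * rcoord (flipJ k) z) * (sgnJ i * sgnJ j * Jc (ev (flipJ i)) (flipJ j)))"
    unfolding dc_fundamental_def Jc_ev[of i] Jc_ev[of j] Jc_ev[of k] d_fundamental_hopf_ev[OF f assms(4)]
    by (simp add: algebra_simps)
  then show ?thesis by (simp only: 1 jcoord_flipJ) (simp add: algebra_simps)
qed

text \<open>In d\<omega> at J of all three arguments, the last two carry J twice and only lose their
  signs, so a single rotated argument remains.\<close>

lemma dc_fundamental_hopf_Jc_ev:
  assumes "i < 4" "j < 4" "k < 4" "z \<in> punctured"
  shows "dc_fundamental 2 (hopf_metric a b) z (ev i) (Jc (ev j)) (Jc (ev k)) =
    2 * b * (inverse (nsq z))\<^sup>2 *
      (- jcoord i z * Jc (ev j) k + rcoord j z * kd i k - rcoord k z * kd i j)"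
proof -
  have f: "flipJ i < 4"
    using flipJ_less[of _ 2] assms by auto
  have m: "(\<lambda>m. - ev j m) = (\<lambda>m. - 1 * ev j m)" for j by simp
  have "dc_fundamental 2 (hopf_metric a b) z (ev i) (Jc (ev j)) (Jc (ev k)) =
    2 * b * (inverse (nsq z))\<^sup>2 *
      ((sgnJ i * rcoord (flipJ i) z) * Jc (ev j) k + rcoord j z * (sgnJ i * Jc (ev k) (flipJ i))
       + rcoord k z * (sgnJ i * Jc (ev (flipJ i)) j))"
    unfolding dc_fundamental_def Jc_Jc_ev unfolding Jc_ev[of i] m d_fundamental_hopf_ev[OF f assms(2-4)]
    by (simp add: algebra_simps)
  then show ?thesis by (simp only: Jc_ev_flipJ jcoord_flipJ) (simp add: algebra_simps)
qed

text \<open>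
  The connection coefficients for $t = 1 + 2\tau$, i.e. the low coefficients of
  \<open>gauduchon_low_hopf\<close> multiplied by the inverse metric, which is
  $\frac{N}{a}$ on the complement of the complex line through $z$ and $\frac{N}{b}$ on that line.
\<close>

definition hopf_conn :: "real \<Rightarrow> real \<Rightarrow> real \<Rightarrow> nat \<Rightarrow> nat \<Rightarrow> coords \<Rightarrow> rvec" where
  "hopf_conn a b \<tau> j l z k = inverse (nsq z) *
     (- (rcoord j z * kd l k)
      + (b - a + \<tau> * b) / a * (rcoord l z * kd j k + jcoord l z * Jc (ev j) k)
      - (a + 2 * \<tau> * b) / a * (jcoord j z * Jc (ev l) k)
      - \<tau> * (kd j l * rcoord k z + Jc (ev j) l * jcoord k z)
      - inverse (nsq z) * (b - a) / a *
        ((1 + \<tau>) * rcoord j z * (rcoord l z * rcoord k z + jcoord l z * jcoord k z)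
         + (1 - \<tau>) * jcoord j z * (rcoord l z * jcoord k z - jcoord l z * rcoord k z)))"

text \<open>With t = 1 + 2\<tau> the two weights, multiplied by the factor 2b of
  \<open>dc_fundamental\<close>, become \<tau> b and (1 + \<tau>) b, and \<tau> = 0 is the Chern
  connection.\<close>

lemma gauduchon_low_hopf:
  assumes "j < 4" "l < 4" "k < 4" "z \<in> punctured"
  shows "gauduchon_low 2 (1 + 2 * \<tau>) (hopf_metric a b) z j l k = (inverse (nsq z))\<^sup>2 *
     (- a * rcoord j z * kd l k
      + (b - a + \<tau> * b) * (rcoord l z * kd j k + jcoord l z * Jc (ev j) k)
      - (a + 2 * \<tau> * b) * (jcoord j z * Jc (ev l) k)
      - rcoord k z * (\<tau> * b * kd j l
         + 2 * (b - a) * inverse (nsq z) * (rcoord j z * rcoord l z - jcoord j z * jcoord l z))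
      - jcoord k z * (\<tau> * b * Jc (ev j) l
         + 2 * (b - a) * inverse (nsq z) * (rcoord j z * jcoord l z + rcoord l z * jcoord j z)))"
proof -
  have t: "(1 + 2 * \<tau> - 1) / 4 * (- 2 * b * u * v) = - \<tau> * b * u * v"
    "(1 + 2 * \<tau> + 1) / 4 * (2 * b * u * v) = (1 + \<tau>) * b * u * v" for u v
    by (auto simp: field_simps)
  have J: "Jc (ev k) j = - Jc (ev j) k" by (rule Jc_ev_antisym)
  show ?thesis
    unfolding gauduchon_low_def levi_civita_low_hopf[OF assms] dc_fundamental_hopf_ev[OF assms]
      dc_fundamental_hopf_Jc_ev[OF assms] t J
    by algebra
qed

section \<open>Lowering an index with the metric\<close>

lemma jcoord_simps [simp]:
  "even k \<Longrightarrow> jcoord k z = - rcoord (Suc k) z" "odd k \<Longrightarrow> jcoord k z = rcoord (k - 1) z"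
  by (simp_all add: jcoord_def Jc_def)

lemma sum_rcoord_rcoord: "(\<Sum>m<4. rcoord m z * rcoord m z) = nsq z"
  by (simp add: nsq_def power2_eq_square)

lemma sum_jcoord_jcoord: "(\<Sum>m<4. jcoord m z * jcoord m z) = nsq z"
  by (simp add: nsq_eq sum_lessThan_4 power2_eq_square)

lemma sum_rcoord_jcoord: "(\<Sum>m<4. rcoord m z * jcoord m z) = 0"
  by (simp add: sum_lessThan_4)

lemma sum_Jc_ev:
  assumes "l < 4"
  shows "(\<Sum>m<4. rcoord m z * Jc (ev l) m) = - jcoord l z"
    and "(\<Sum>m<4. jcoord m z * Jc (ev l) m) = rcoord l z"
  using less_4_cases[OF assms] by (auto simp: sum_lessThan_4 Jc_def ev_def)

lemma sum_kd: "k < 4 \<Longrightarrow> (\<Sum>m<4. kd m k * F m) = F k" "k < 4 \<Longrightarrow> (\<Sum>m<4. F m * kd k m) = F k"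
  using less_4_cases[of k] by (auto simp: sum_lessThan_4 kd_def)

lemma hopf_metric_contract:
  assumes "k < 4"
  shows "(\<Sum>m<4. hopf_metric a b z m k * F m) =
    a * inverse (nsq z) * F k
    + (b - a) * (inverse (nsq z))\<^sup>2 *
      (rcoord k z * (\<Sum>m<4. rcoord m z * F m) + jcoord k z * (\<Sum>m<4. jcoord m z * F m))"
proof -
  have "(\<Sum>m<4. hopf_metric a b z m k * F m) =
    (\<Sum>m<4. a * inverse (nsq z) * (kd m k * F m)
      + (b - a) * (inverse (nsq z))\<^sup>2 * (rcoord k z * (rcoord m z * F m) + jcoord k z * (jcoord m z * F m)))"
    unfolding hopf_metric_def by (intro sum.cong refl) algebra
  then show ?thesis
    by (simp only: sum.distrib sum_distrib_left[symmetric] sum_kd(1)[OF assms])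
qed

text \<open>Both vectors lie in the line where the metric is b/N: the eigenvalue is a/N + ((b -
  a)/N^2) N.\<close>

lemma hopf_metric_contract_rcoord:
  assumes "k < 4" "z \<in> punctured"
  shows "(\<Sum>m<4. hopf_metric a b z m k * rcoord m z) = b * inverse (nsq z) * rcoord k z"
    and "(\<Sum>m<4. hopf_metric a b z m k * jcoord m z) = b * inverse (nsq z) * jcoord k z"
proof -
  have "nsq z \<noteq> 0" using assms by (simp add: punctured_def)
  then show "(\<Sum>m<4. hopf_metric a b z m k * rcoord m z) = b * inverse (nsq z) * rcoord k z"
    "(\<Sum>m<4. hopf_metric a b z m k * jcoord m z) = b * inverse (nsq z) * jcoord k z"
    unfolding hopf_metric_contract[OF assms(1)] sum_rcoord_rcoord sum_jcoord_jcoord sum_rcoord_jcoord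
      mult.commute[of "jcoord _ z" "rcoord _ z"]
    by (simp_all add: field_simps power2_eq_square del: jcoord_simps)
qed

text \<open>As a vector in its last index, the candidate is a combination of the coordinate vectors
  l and j, their images under J, the position vector and its image under J. Each of these six is
  lowered by a contraction formula already at hand.\<close>

lemma hopf_conn_solves:
  assumes "j < 4" "l < 4" "k < 4" "z \<in> punctured" "a \<noteq> 0"
  shows "(\<Sum>m<4. hopf_metric a b z m k * hopf_conn a b \<tau> j l z m) =
    gauduchon_low 2 (1 + 2 * \<tau>) (hopf_metric a b) z j l k"
proof -
  define u where "u = inverse (nsq z)"
  \<comment> \<open>Replacing 1/a by a variable with a r = 1 turns the claim into a polynomial
    identity for \<open>algebra\<close>.\<close>
  define r where "r = inverse a"
  have r: "a * r = 1" using assms by (simp add: r_def)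
  define c2 where "c2 = (b - a + \<tau> * b) * r"
  define c3 where "c3 = (a + 2 * \<tau> * b) * r"
  define d where "d = u * (b - a) * r"
  have conn: "hopf_conn a b \<tau> j l z m =
    u * (- rcoord j z) * kd l m + u * c2 * rcoord l z * kd j m + u * c2 * jcoord l z * Jc (ev j) m
    - u * c3 * jcoord j z * Jc (ev l) m
    - u * (\<tau> * kd j l + d * ((1 + \<tau>) * rcoord j z * rcoord l z - (1 - \<tau>) * jcoord j z * jcoord l z)) * rcoord m z
    - u * (\<tau> * Jc (ev j) l + d * ((1 + \<tau>) * rcoord j z * jcoord l z + (1 - \<tau>) * jcoord j z * rcoord l z)) * jcoord m z" for m
    unfolding hopf_conn_def c2_def c3_def d_def divide_inverse u_def[symmetric] r_def[symmetric]
    by algebra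
  define G where "G = hopf_metric a b z"
  have "(\<Sum>m<4. G m k * hopf_conn a b \<tau> j l z m) =
    u * (- rcoord j z) * (\<Sum>m<4. G m k * kd l m) + u * c2 * rcoord l z * (\<Sum>m<4. G m k * kd j m)
    + u * c2 * jcoord l z * (\<Sum>m<4. G m k * Jc (ev j) m)
    - u * c3 * jcoord j z * (\<Sum>m<4. G m k * Jc (ev l) m)
    - u * (\<tau> * kd j l + d * ((1 + \<tau>) * rcoord j z * rcoord l z - (1 - \<tau>) * jcoord j z * jcoord l z)) * (\<Sum>m<4. G m k * rcoord m z)
    - u * (\<tau> * Jc (ev j) l + d * ((1 + \<tau>) * rcoord j z * jcoord l z + (1 - \<tau>) * jcoord j z * rcoord l z)) * (\<Sum>m<4. G m k * jcoord m z)"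
    unfolding conn sum_distrib_left sum.distrib[symmetric] sum_subtractf[symmetric]
    by (intro sum.cong refl) algebra
  also have "\<dots> = u\<^sup>2 *
     (- a * rcoord j z * kd l k
      + (b - a + \<tau> * b) * (rcoord l z * kd j k + jcoord l z * Jc (ev j) k)
      - (a + 2 * \<tau> * b) * (jcoord j z * Jc (ev l) k)
      - rcoord k z * (\<tau> * b * kd j l
         + 2 * (b - a) * u * (rcoord j z * rcoord l z - jcoord j z * jcoord l z))
      - jcoord k z * (\<tau> * b * Jc (ev j) l
         + 2 * (b - a) * u * (rcoord j z * jcoord l z + rcoord l z * jcoord j z)))"
    unfolding G_def hopf_metric_contract_rcoord[OF assms(3,4)] hopf_metric_contract[OF assms(3)]
      sum_kd(2)[OF assms(1)] sum_kd(2)[OF assms(2)] sum_Jc_ev[OF assms(1)] sum_Jc_ev[OF assms(2)]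
      c2_def c3_def d_def u_def[symmetric]
    using r by algebra
  finally show ?thesis unfolding gauduchon_low_hopf[OF assms(1-4)] G_def u_def .
qed


subsection \<open>The Ricci forms\<close>

lemma hermitian_form_hopf_metric:
  assumes "z \<in> punctured" "a > 0" "b > 0"
  shows "hermitian_form 2 (hopf_metric a b z)"
  unfolding hermitian_form_def
proof (intro conjI allI impI)
  fix i j show "hopf_metric a b z i j = hopf_metric a b z j i"
    by (simp add: hopf_metric_def kd_sym mult.commute del: jcoord_simps)
next
  have N: "nsq z > 0" using assms by (simp add: punctured_def)
  have bil: "bil 2 (hopf_metric a b z) X Y =
    a * inverse (nsq z) * (\<Sum>m<4. X m * Y m) + (b - a) * (inverse (nsq z))\<^sup>2 *
     ((\<Sum>m<4. rcoord m z * X m) * (\<Sum>m<4. rcoord m z * Y m)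
      + (\<Sum>m<4. jcoord m z * X m) * (\<Sum>m<4. jcoord m z * Y m))" for X Y
    unfolding bil_def hopf_metric_def
    by (simp add: sum_lessThan_4 kd_def) algebra
  {
    fix X :: rvec assume "\<exists>i<2*2. X i \<noteq> 0"
    then obtain i where "i < 4" "X i \<noteq> 0" by auto
    define n where "n = (\<Sum>m<4. (X m)\<^sup>2)"
    define q where "q = (\<Sum>m<4. rcoord m z * X m)\<^sup>2 + (\<Sum>m<4. jcoord m z * X m)\<^sup>2"
    have n: "n > 0"
      unfolding n_def using \<open>i < 4\<close> \<open>X i \<noteq> 0\<close> by (intro sum_pos2[of _ i]) auto
    have q: "q \<ge> 0" by (simp add: q_def)
    \<comment> \<open>Lagrange's identity in complex dimension 2: q is the squared modulus of the
      Hermitian product of X with z, and the two squares are the real and imaginary parts of the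
      determinant of z and X.\<close>
    have "nsq z * n - q =
      (rcoord 0 z * X 2 - rcoord 1 z * X 3 - rcoord 2 z * X 0 + rcoord 3 z * X 1)\<^sup>2
      + (rcoord 0 z * X 3 + rcoord 1 z * X 2 - rcoord 2 z * X 1 - rcoord 3 z * X 0)\<^sup>2"
      unfolding n_def q_def nsq_eq by (simp add: sum_lessThan_4) algebra
    then have qn: "nsq z * n - q \<ge> 0" by simp
    have "bil 2 (hopf_metric a b z) X X = (a * (nsq z * n - q) + b * q) * (inverse (nsq z))\<^sup>2"
      unfolding bil n_def q_def using N by (simp add: field_simps power2_eq_square)
    moreover have "a * (nsq z * n - q) + b * q > 0"
    proof (cases "q = 0")
      case True
      then show ?thesis using N n assms by simp
    next
      case False
      then show ?thesis using q qn assms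
        by (intro add_nonneg_pos mult_nonneg_nonneg mult_pos_pos) auto
    qed
    ultimately show "bil 2 (hopf_metric a b z) X X > 0" using N by simp
  next
    fix X Y :: rvec
    show "bil 2 (hopf_metric a b z) (Jc X) (Jc Y) = bil 2 (hopf_metric a b z) X Y"
      unfolding bil by (simp add: sum_lessThan_4 Jc_def) algebra
  }
qed

text \<open>The connection vector is padded with zeros, whereas \<open>hopf_conn\<close> is a
  formula in every index k; hence the truncation at 4.\<close>

lemma gauduchon_conn_hopf:
  assumes "j < 4" "l < 4" "z \<in> punctured" "a > 0" "b > 0"
  shows "gauduchon_conn 2 (1 + 2 * \<tau>) (hopf_metric a b) j l z =
    (\<lambda>k. if k < 4 then hopf_conn a b \<tau> j l z k else 0)"
proof (rule gauduchon_conn_eqI)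
  show "hermitian_form 2 (hopf_metric a b z)"
    by (rule hermitian_form_hopf_metric[OF assms(3-5)])
  fix k :: nat assume "k < 2*2"
  then show "bil 2 (hopf_metric a b z) (\<lambda>k. if k < 4 then hopf_conn a b \<tau> j l z k else 0) (ev k) =
      gauduchon_low 2 (1 + 2 * \<tau>) (hopf_metric a b) z j l k"
    using hopf_conn_solves[OF assms(1,2) _ assms(3), of k a b \<tau>] assms(4) by (simp add: bil_ev_right)
qed simp

text \<open>Parallelism of J in components: for even l the vector J\<partial>_l is \<partial>_{l+1},
  and its derivative is J applied to that of \<partial>_l.\<close>

lemma hopf_conn_J_linear:
  assumes "even l" "even k"
  shows "hopf_conn a b \<tau> j (Suc l) z k = - hopf_conn a b \<tau> j l z (Suc k)"
    and "hopf_conn a b \<tau> j (Suc l) z (Suc k) = hopf_conn a b \<tau> j l z k"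
proof -
  have x: "rcoord (Suc m) z = - jcoord m z" "jcoord (Suc m) z = rcoord m z" if "even m" for m
    using that by simp_all
  have kd: "kd (Suc l) k = 0" "kd l (Suc k) = 0" "kd (Suc l) (Suc k) = kd l k"
    using assms by (auto simp: kd_def)
  have E: "Jc (ev m) k = - kd m (Suc k)" "Jc (ev m) (Suc k) = kd m k" for m
    using assms by (auto simp: Jc_def ev_def kd_def)
  have E': "Jc (ev m) l = - kd m (Suc l)" "Jc (ev m) (Suc l) = kd m l" for m
    using assms by (auto simp: Jc_def ev_def kd_def)
  show "hopf_conn a b \<tau> j (Suc l) z k = - hopf_conn a b \<tau> j l z (Suc k)"
    "hopf_conn a b \<tau> j (Suc l) z (Suc k) = hopf_conn a b \<tau> j l z k"
    unfolding hopf_conn_def divide_inverse x[OF assms(1)] x[OF assms(2)] E E' kd kd_sym[of "Suc l" j] 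
    by algebra+
qed

text \<open>The real part is the exact form -d(log N) for all parameters and contributes no
  curvature; the torsion shows only in the imaginary part, as \<tau> b/a.\<close>

lemma hopf_conn_trace:
  assumes "j < 4" "z \<in> punctured" "a \<noteq> 0"
  shows "hopf_conn a b \<tau> j 0 z 0 + hopf_conn a b \<tau> j 2 z 2 = - 2 * (rcoord j z * inverse (nsq z))"
    and "hopf_conn a b \<tau> j 0 z 1 + hopf_conn a b \<tau> j 2 z 3 =
           - 2 * (1 + \<tau> * b / a) * (jcoord j z * inverse (nsq z))"
proof -
  define u where "u = inverse (nsq z)"
  define r where "r = inverse a"
  have r: "a * r = 1" using assms by (simp add: r_def)
  have u: "u * ((rcoord 0 z)\<^sup>2 + (rcoord 1 z)\<^sup>2 + (rcoord 2 z)\<^sup>2 + (rcoord 3 z)\<^sup>2) = 1"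
    using punctured_inverse_nsq[OF assms(2)] by (simp add: u_def)
  have E: "Jc (ev m) 0 = - kd m 1" "Jc (ev m) 1 = kd m 0" "Jc (ev m) 2 = - kd m 3" "Jc (ev m) 3 = kd m 2" for m
    by (auto simp: Jc_def ev_def kd_def)
  have j: "jcoord 0 z = - rcoord 1 z" "jcoord 1 z = rcoord 0 z" "jcoord 2 z = - rcoord 3 z" "jcoord 3 z = rcoord 2 z"
    by simp_all
  have kd: "kd 0 0 = 1" "kd 2 2 = 1" "kd 0 1 = 0" "kd 2 3 = 0"
    by (auto simp: kd_def)
  \<comment> \<open>The deltas in j enter the two traces only through these combinations, up to
    sign.\<close>
  have x: "rcoord 0 z * kd j 0 + rcoord 1 z * kd j 1 + rcoord 2 z * kd j 2 + rcoord 3 z * kd j 3 = rcoord j z"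
    "- rcoord 1 z * kd j 0 + rcoord 0 z * kd j 1 - rcoord 3 z * kd j 2 + rcoord 2 z * kd j 3 = jcoord j z"
    using sum_kd(2)[OF assms(1), of "\<lambda>m. rcoord m z"] sum_kd(2)[OF assms(1), of "\<lambda>m. jcoord m z"]
    by (simp_all add: sum_lessThan_4)
  show "hopf_conn a b \<tau> j 0 z 0 + hopf_conn a b \<tau> j 2 z 2 = - 2 * (rcoord j z * inverse (nsq z))"
    using u r x
    unfolding hopf_conn_def divide_inverse u_def[symmetric] r_def[symmetric] E kd j
    by algebra
  show "hopf_conn a b \<tau> j 0 z 1 + hopf_conn a b \<tau> j 2 z 3 =
           - 2 * (1 + \<tau> * b / a) * (jcoord j z * inverse (nsq z))"
    using u r x
    unfolding hopf_conn_def divide_inverse u_def[symmetric] r_def[symmetric] E kd j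
    by algebra
qed

lemma rational_family_hopf_conn: "rational_family (\<lambda>_ w. hopf_conn a b \<tau> j l w k)"
  unfolding hopf_conn_def divide_inverse jcoord_def Jc_def
  by (intro rational_family_intros rational_family.inv)

lemma rational_family_hopf_metric:
  "rational_family (\<lambda>s w. hopf_metric (p + q * s) b w i j)"
  unfolding hopf_metric_def jcoord_def Jc_def
  by (intro rational_family_intros rational_family.inv)

text \<open>Additivity of \<open>pd\<close> requires differentiable summands; membership in the
  class supplies it.\<close>

lemma pd_add_rational_family:
  assumes "rational_family (\<lambda>_. f)" "rational_family (\<lambda>_. g)" "i < 4" "z \<in> punctured"
  shows "pd i (\<lambda>w. f w + g w) z = pd i f z + pd i g z"
proof -
  obtain d e where "((\<lambda>r. f (move i r z)) has_real_derivative d) (at 0)"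
    "((\<lambda>r. g (move i r z)) has_real_derivative e) (at 0)"
    using rational_family_space_derivative[OF assms(1,3)] rational_family_space_derivative[OF assms(2,3)]
      assms(4) by metis
  then show ?thesis using DERIV_add by (metis pd_eqI[of "\<lambda>w. f w + g w"] pd_eqI)
qed

lemma pd_hopf_conn_trace:
  assumes "i < 4" "j < 4" "z \<in> punctured" "a \<noteq> 0"
  shows "pd i (\<lambda>w. hopf_conn a b \<tau> j 0 w 0) z + pd i (\<lambda>w. hopf_conn a b \<tau> j 2 w 2) z =
      - 2 * (inverse (nsq z) * kd i j - 2 * (inverse (nsq z))\<^sup>2 * rcoord i z * rcoord j z)"
    and "pd i (\<lambda>w. hopf_conn a b \<tau> j 0 w 1) z + pd i (\<lambda>w. hopf_conn a b \<tau> j 2 w 3) z =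
      - 2 * (1 + \<tau> * b / a) *
        (inverse (nsq z) * Jc (ev i) j - 2 * (inverse (nsq z))\<^sup>2 * rcoord i z * jcoord j z)"
proof -
  have "pd i (\<lambda>w. hopf_conn a b \<tau> j 0 w 0) z + pd i (\<lambda>w. hopf_conn a b \<tau> j 2 w 2) z =
      pd i (\<lambda>w. hopf_conn a b \<tau> j 0 w 0 + hopf_conn a b \<tau> j 2 w 2) z"
    by (rule pd_add_rational_family[OF rational_family_hopf_conn rational_family_hopf_conn assms(1,3), symmetric])
  also have "\<dots> = pd i (\<lambda>w. - 2 * (rcoord j w * inverse (nsq w))) z"
    by (rule pd_cong_open[OF open_punctured assms(3)]) (rule hopf_conn_trace[OF assms(2) _ assms(4)])
  also have "\<dots> = - 2 * (inverse (nsq z) * kd i j - 2 * (inverse (nsq z))\<^sup>2 * rcoord i z * rcoord j z)"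
    by (rule pd_eqI, (rule derivative_eq_intros has_real_derivative_inverse_nsq_move[OF assms(1,3)] refl)+)
       (simp add: kd_def)
  finally show "pd i (\<lambda>w. hopf_conn a b \<tau> j 0 w 0) z + pd i (\<lambda>w. hopf_conn a b \<tau> j 2 w 2) z =
      - 2 * (inverse (nsq z) * kd i j - 2 * (inverse (nsq z))\<^sup>2 * rcoord i z * rcoord j z)" .
  have "pd i (\<lambda>w. hopf_conn a b \<tau> j 0 w 1) z + pd i (\<lambda>w. hopf_conn a b \<tau> j 2 w 3) z =
      pd i (\<lambda>w. hopf_conn a b \<tau> j 0 w 1 + hopf_conn a b \<tau> j 2 w 3) z"
    by (rule pd_add_rational_family[OF rational_family_hopf_conn rational_family_hopf_conn assms(1,3), symmetric])
  also have "\<dots> = pd i (\<lambda>w. - 2 * (1 + \<tau> * b / a) * (jcoord j w * inverse (nsq w))) z"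
    by (rule pd_cong_open[OF open_punctured assms(3)]) (rule hopf_conn_trace[OF assms(2) _ assms(4)])
  also have "\<dots> = - 2 * (1 + \<tau> * b / a) *
      (inverse (nsq z) * Jc (ev i) j - 2 * (inverse (nsq z))\<^sup>2 * rcoord i z * jcoord j z)"
    by (rule pd_eqI, (rule derivative_eq_intros has_real_derivative_inverse_nsq_move[OF assms(1,3)] refl)+)
       (simp del: jcoord_simps)
  finally show "pd i (\<lambda>w. hopf_conn a b \<tau> j 0 w 1) z + pd i (\<lambda>w. hopf_conn a b \<tau> j 2 w 3) z =
      - 2 * (1 + \<tau> * b / a) *
        (inverse (nsq z) * Jc (ev i) j - 2 * (inverse (nsq z))\<^sup>2 * rcoord i z * jcoord j z)" .
qed

lemma curvature_hopf:
  assumes "i < 4" "j < 4" "l < 4" "k < 4" "z \<in> punctured" "a > 0" "b > 0"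
  shows "curvature 2 (1 + 2 * \<tau>) (hopf_metric a b) z i j l k =
    pd i (\<lambda>w. hopf_conn a b \<tau> j l w k) z
      + (\<Sum>m<4. hopf_conn a b \<tau> j l z m * hopf_conn a b \<tau> i m z k)
    - (pd j (\<lambda>w. hopf_conn a b \<tau> i l w k) z
      + (\<Sum>m<4. hopf_conn a b \<tau> i l z m * hopf_conn a b \<tau> j m z k))"
proof -
  \<comment> \<open>The closed formula for the connection holds on all of \<open>punctured\<close>,
    so it may be differentiated there.\<close>
  have "pd i (\<lambda>w. gauduchon_conn 2 (1 + 2 * \<tau>) (hopf_metric a b) j l w k) z =
      pd i (\<lambda>w. hopf_conn a b \<tau> j l w k) z" if "j < 4" for i j
    using that assms(3-7) by (intro pd_cong_open[OF open_punctured]) (auto simp: gauduchon_conn_hopf)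
  then show ?thesis
    using assms by (simp add: curvature_def covariant_deriv_def gauduchon_conn_hopf)
qed

text \<open>
  Since $\nabla^t J = 0$, the quadratic part of the curvature is a commutator of complex matrices
  and does not contribute to the trace.
\<close>

lemma complex_trace_curvature_hopf:
  assumes "i < 4" "j < 4" "z \<in> punctured" "a > 0" "b > 0"
  shows "complex_trace 2 (curvature 2 (1 + 2 * \<tau>) (hopf_metric a b) z i j) =
    Complex 0 (- 4 * (1 + \<tau> * b / a) * fundamental_form 2 (hopf_metric 1 0) z (ev i) (ev j))"
proof -
  let ?R = "curvature 2 (1 + 2 * \<tau>) (hopf_metric a b) z i j"
  let ?\<Gamma> = "\<lambda>j l k. hopf_conn a b \<tau> j l z k"
  have a: "a \<noteq> 0" using assms by simp
  \<comment> \<open>Eliminating the odd lower indices leaves the real and imaginary parts of 2 x 2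
    complex matrices.\<close>
  have J: "?\<Gamma> j 1 0 = - ?\<Gamma> j 0 1" "?\<Gamma> j 1 1 = ?\<Gamma> j 0 0" "?\<Gamma> j 1 2 = - ?\<Gamma> j 0 3" "?\<Gamma> j 1 3 = ?\<Gamma> j 0 2"
    "?\<Gamma> j 3 0 = - ?\<Gamma> j 2 1" "?\<Gamma> j 3 1 = ?\<Gamma> j 2 0" "?\<Gamma> j 3 2 = - ?\<Gamma> j 2 3" "?\<Gamma> j 3 3 = ?\<Gamma> j 2 2" for j
    using hopf_conn_J_linear[of 0 0] hopf_conn_J_linear[of 0 2] hopf_conn_J_linear[of 2 0]
      hopf_conn_J_linear[of 2 2] by (simp_all add: numeral_3_eq_3 numeral_2_eq_2)
  have E: "Jc (ev j) i = - Jc (ev i) j" by (rule Jc_ev_antisym)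
  have "?R 0 0 + ?R 2 2 =
    (pd i (\<lambda>w. hopf_conn a b \<tau> j 0 w 0) z + pd i (\<lambda>w. hopf_conn a b \<tau> j 2 w 2) z)
    - (pd j (\<lambda>w. hopf_conn a b \<tau> i 0 w 0) z + pd j (\<lambda>w. hopf_conn a b \<tau> i 2 w 2) z)"
    using assms by (simp only: curvature_hopf sum_lessThan_4 J, simp add: curvature_hopf sum_lessThan_4 J)
  \<comment> \<open>The derivative of the exact real part is a Hessian, symmetric in i and
    j.\<close>
  also have "\<dots> = 0"
    using assms by (simp add: pd_hopf_conn_trace kd_sym)
  finally have 1: "?R 0 0 + ?R 2 2 = 0" .
  have "?R 0 1 + ?R 2 3 =
    (pd i (\<lambda>w. hopf_conn a b \<tau> j 0 w 1) z + pd i (\<lambda>w. hopf_conn a b \<tau> j 2 w 3) z)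
    - (pd j (\<lambda>w. hopf_conn a b \<tau> i 0 w 1) z + pd j (\<lambda>w. hopf_conn a b \<tau> i 2 w 3) z)"
    using assms by (simp only: curvature_hopf sum_lessThan_4 J, simp add: curvature_hopf sum_lessThan_4 J)
  \<comment> \<open>Antisymmetrizing the derivative of \<open>jcoord\<close> over N yields 2
    \<omega>_{1,0}, which turns the coefficient -2 into -4.\<close>
  also have "\<dots> = - 4 * (1 + \<tau> * b / a) * fundamental_form 2 (hopf_metric 1 0) z (ev i) (ev j)"
    unfolding pd_hopf_conn_trace(2)[OF assms(1-3) a] pd_hopf_conn_trace(2)[OF assms(2,1,3) a]
      fundamental_form_hopf_ev[OF assms(1,2)] E
    by algebra
  finally have 2: "?R 0 1 + ?R 2 3 = \<dots>" .
  from 1 2 show ?thesis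
    by (simp add: complex_trace_def complex_eq_iff eval_nat_numeral)
qed

lemma fundamental_form_hopf_expand:
  "fundamental_form 2 (hopf_metric a b) z X Y =
    (\<Sum>i<4. \<Sum>j<4. fundamental_form 2 (hopf_metric a b) z (ev i) (ev j) * (X i * Y j))"
  unfolding fundamental_form_def bil_def
  by (simp add: sum_lessThan_4 Jc_def ev_def algebra_simps flip: numeral_3_eq_3)

text \<open>The trace of the curvature is purely imaginary, so multiplication by the imaginary unit
  makes the form real. At \<tau> = 0 the result is 4 \<omega>_{1,0} for every a and b, which makes
  the Chern-Ricci flow affine on this family.\<close>

lemma ricci_form_hopf:
  assumes "z \<in> punctured" "a > 0" "b > 0"
  shows "ricci_form 2 (1 + 2 * \<tau>) (hopf_metric a b) z X Y =
    of_real (4 * (1 + \<tau> * b / a) * fundamental_form 2 (hopf_metric 1 0) z X Y)"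
proof -
  have "ricci_form 2 (1 + 2 * \<tau>) (hopf_metric a b) z X Y = (\<Sum>i<4. \<Sum>j<4.
     of_real (4 * (1 + \<tau> * b / a) * (fundamental_form 2 (hopf_metric 1 0) z (ev i) (ev j) * (X i * Y j))))"
    unfolding ricci_form_def
    by (intro sum.cong refl) (use assms in \<open>auto simp: complex_trace_curvature_hopf complex_eq_iff, simp add: algebra_simps\<close>)
  then show ?thesis
    unfolding fundamental_form_hopf_expand[of _ _ _ X Y] sum_distrib_left of_real_sum by simp
qed


subsection \<open>The Hopf surface\<close>

text \<open>
  The quotient is embedded by $z \mapsto (z/|z|, e^{\sqrt{-1}\log|z|})$, so a chart amounts to a
  branch of the logarithm of the last coordinate; the branch cuts at $-\eta$ for
  $\eta = \pm 1$ leave two charts covering the surface.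
\<close>

definition hopf_surface :: "coords set" where
  "hopf_surface =
     {w. (cmod (w 0))\<^sup>2 + (cmod (w 1))\<^sup>2 = 1 \<and> cmod (w 2) = 1 \<and> (\<forall>j\<ge>3. w j = 0)}"

definition hopf_domain :: "real \<Rightarrow> coords set" where
  "hopf_domain \<eta> = {w \<in> hopf_surface. of_real \<eta> * w 2 \<notin> \<real>\<^sub>\<le>\<^sub>0}"

definition hopf_coord :: "real \<Rightarrow> coords \<Rightarrow> coords" where
  "hopf_coord \<eta> w = (\<lambda>k. if k < 2 then of_real (exp (Arg (of_real \<eta> * w 2))) * w k else 0)"

definition hopf_atlas :: "coords chart set" where
  "hopf_atlas = (\<lambda>\<eta>. (hopf_domain \<eta>, hopf_coord \<eta>)) ` {1, -1}"

text \<open>The bounds come from N = exp (2 \<theta>) with \<theta> between -pi and pi. Both charts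
  have this image: for \<eta> = -1 the angle is measured from -1, which rescales z by exp pi or exp
  (- pi) relative to the other chart.\<close>

definition annulus :: "coords set" where
  "annulus = {z \<in> Cspace 2. exp (- 2 * pi) < nsq z \<and> nsq z < exp (2 * pi)}"

definition hopf_param :: "real \<Rightarrow> coords \<Rightarrow> coords" where
  "hopf_param \<eta> z = (\<lambda>k. if k < 2 then z k / of_real (sqrt (nsq z))
     else if k = 2 then of_real \<eta> * cis (ln (nsq z) / 2) else 0)"

section \<open>Compactness and the two charts\<close>

lemma continuous_on_coordinate [continuous_intros]:
  "continuous_on S (\<lambda>x. x i :: 'b::topological_space)"
  by (rule continuous_on_subset[OF continuous_on_product_coordinates]) simp

text \<open>The surface is closed in a product of three discs and infinitely many points, which is
  compact by Tychonoff's theorem.\<close>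

lemma compact_hopf_surface: "compact hopf_surface"
proof -
  let ?K = "\<lambda>i::nat. if i < 3 then cball 0 1 else {0} :: complex set"
  have "compactin (product_topology (\<lambda>_. euclidean) UNIV) (PiE UNIV ?K)"
    by (subst compactin_PiE) auto
  then have K: "compact (PiE UNIV ?K)" by (simp add: euclidean_product_topology)
  have "closed {w :: coords. (cmod (w 0))\<^sup>2 + (cmod (w 1))\<^sup>2 = 1}"
    "closed {w :: coords. cmod (w 2) = 1}"
    by (intro closed_Collect_eq continuous_intros)+
  then have "compact (PiE UNIV ?K \<inter>
      ({w. (cmod (w 0))\<^sup>2 + (cmod (w 1))\<^sup>2 = 1} \<inter> {w. cmod (w 2) = 1}))"
    by (intro compact_Int_closed K closed_Int)
  also have "PiE UNIV ?K \<inter> ({w. (cmod (w 0))\<^sup>2 + (cmod (w 1))\<^sup>2 = 1} \<inter> {w. cmod (w 2) = 1}) =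
      hopf_surface"
  proof (intro equalityI subsetI)
    fix w assume w: "w \<in> hopf_surface"
    have "cmod (w i) \<le> 1" if "i < 3" for i
    proof -
      have "(cmod (w 0))\<^sup>2 \<le> 1" "(cmod (w 1))\<^sup>2 \<le> 1" using w
        by (auto simp: hopf_surface_def) (metis le_add_same_cancel1 le_add_same_cancel2 zero_le_power2)+
      then have "cmod (w 0) \<le> 1" "cmod (w 1) \<le> 1" by (auto simp: abs_square_le_1)
      moreover have "i = 0 \<or> i = 1 \<or> i = 2" using that by linarith
      ultimately show ?thesis using w by (auto simp: hopf_surface_def)
    qed
    with w show "w \<in> PiE UNIV ?K \<inter> ({w. (cmod (w 0))\<^sup>2 + (cmod (w 1))\<^sup>2 = 1} \<inter> {w. cmod (w 2) = 1})"
      by (auto simp: hopf_surface_def PiE_iff)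
  qed (auto simp: hopf_surface_def PiE_iff split: if_splits, metis not_less)
  finally show ?thesis .
qed

lemma Arg_bounds:
  assumes "z \<notin> \<real>\<^sub>\<le>\<^sub>0"
  shows "- pi < Arg z" "Arg z < pi"
proof -
  show "- pi < Arg z" by (rule mpi_less_Arg)
  have "Arg z \<noteq> pi"
    using assms by (auto simp: Arg_eq_pi complex_nonpos_Reals_iff)
  with Arg_le_pi[of z] show "Arg z < pi" by simp
qed

lemma cis_notin_nonpos_Reals:
  assumes "- pi < \<theta>" "\<theta> < pi"
  shows "cis \<theta> \<notin> \<real>\<^sub>\<le>\<^sub>0"
proof
  assume "cis \<theta> \<in> \<real>\<^sub>\<le>\<^sub>0"
  moreover have "cis \<theta> \<noteq> 0" by simp
  ultimately have "Arg (cis \<theta>) = pi"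
    by (auto simp: Arg_eq_pi complex_nonpos_Reals_iff complex_eq_iff)
  then show False using assms by (simp add: Arg_cis)
qed

lemma nsq_scale: "nsq (\<lambda>k. if k < 2 then of_real c * w k else 0) = c\<^sup>2 * nsq w"
  by (simp add: nsq_cmod norm_mult power_mult_distrib algebra_simps)

lemma nsq_hopf_coord:
  "w \<in> hopf_surface \<Longrightarrow> nsq (hopf_coord \<eta> w) = exp (2 * Arg (of_real \<eta> * w 2))"
  unfolding hopf_coord_def nsq_scale by (simp add: hopf_surface_def nsq_cmod exp_double)

lemma hopf_coord_in_annulus:
  assumes "w \<in> hopf_domain \<eta>"
  shows "hopf_coord \<eta> w \<in> annulus"
  using assms Arg_bounds[of "of_real \<eta> * w 2"]
  by (auto simp: annulus_def hopf_domain_def nsq_hopf_coord) (simp add: hopf_coord_def Cspace_def)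

lemma hopf_param_coord:
  assumes "w \<in> hopf_domain \<eta>" "\<eta> \<in> {1, -1}"
  shows "hopf_param \<eta> (hopf_coord \<eta> w) = w"
proof
  fix k
  define \<theta> where "\<theta> = Arg (of_real \<eta> * w 2)"
  have w: "w \<in> hopf_surface" using assms by (simp add: hopf_domain_def)
  have N: "nsq (hopf_coord \<eta> w) = exp (2 * \<theta>)" using nsq_hopf_coord[OF w] by (simp add: \<theta>_def)
  have r: "sqrt (exp (2 * \<theta>)) = exp \<theta>" by (simp add: exp_double)
  have "cmod (of_real \<eta> * w 2) = 1" using w assms by (auto simp: hopf_surface_def norm_mult)
  then have "cis \<theta> = of_real \<eta> * w 2" 
    unfolding \<theta>_def by (subst cis_Arg) (auto simp: sgn_eq)
  then have "of_real \<eta> * cis \<theta> = w 2" using assms by auto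
  moreover have "w k = 0" if "k \<ge> 3" using w that by (simp add: hopf_surface_def)
  ultimately show "hopf_param \<eta> (hopf_coord \<eta> w) k = w k"
    by (auto simp: hopf_param_def N r) (simp add: hopf_coord_def flip: \<theta>_def)
qed

lemma annulus_nsq:
  assumes "z \<in> annulus"
  shows "nsq z > 0" "- pi < ln (nsq z) / 2" "ln (nsq z) / 2 < pi"
proof -
  show 1: "nsq z > 0"
    using assms less_trans[OF exp_gt_zero] unfolding annulus_def by blast
  show "- pi < ln (nsq z) / 2" "ln (nsq z) / 2 < pi"
    using assms ln_less_cancel_iff[OF exp_gt_zero 1, of "- 2 * pi"]
      ln_less_cancel_iff[OF 1 exp_gt_zero, of "2 * pi"] by (auto simp: annulus_def)
qed

lemma exp_half_ln: "x > 0 \<Longrightarrow> exp (ln x / 2) = sqrt (x::real)"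
  using exp_ln[of "sqrt x"] by (simp add: ln_sqrt)

text \<open>One computation for two purposes: \<eta>' = \<eta> gives the inverse law of a chart,
  \<eta>' = -\<eta> the transition map. Either way z is scaled by a real factor depending on N
  only.\<close>

lemma hopf_coord_param:
  assumes "z \<in> annulus" "\<eta> \<in> {1, -1}" "\<eta>' \<in> {1, -1}"
  shows "hopf_coord \<eta>' (hopf_param \<eta> z) =
    (\<lambda>k. of_real (exp (Arg (of_real (\<eta>' * \<eta>) * cis (ln (nsq z) / 2)) - ln (nsq z) / 2)) * z k)"
proof
  fix k
  have N: "nsq z > 0" by (rule annulus_nsq[OF assms(1)])
  have "z k = 0" if "k \<ge> 2" using assms(1) that by (simp add: annulus_def Cspace_def)
  then show "hopf_coord \<eta>' (hopf_param \<eta> z) k =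
    of_real (exp (Arg (of_real (\<eta>' * \<eta>) * cis (ln (nsq z) / 2)) - ln (nsq z) / 2)) * z k"
    by (simp add: hopf_coord_def hopf_param_def exp_diff exp_half_ln[OF N] mult.assoc)
qed

lemma hopf_coord_param_same:
  assumes "z \<in> annulus" "\<eta> \<in> {1, -1}"
  shows "hopf_coord \<eta> (hopf_param \<eta> z) = z"
proof -
  have "of_real (\<eta> * \<eta>) * cis (ln (nsq z) / 2) = cis (ln (nsq z) / 2)" using assms by auto
  then show ?thesis
    unfolding hopf_coord_param[OF assms(1,2,2)] using annulus_nsq[OF assms(1)] by (simp add: Arg_cis)
qed

lemma hopf_param_in_domain:
  assumes "z \<in> annulus" "\<eta> \<in> {1, -1}"
  shows "hopf_param \<eta> z \<in> hopf_domain \<eta>"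
proof -
  have N: "nsq z > 0" by (rule annulus_nsq[OF assms(1)])
  have "of_real \<eta> * (of_real \<eta> * cis (ln (nsq z) / 2)) = cis (ln (nsq z) / 2)" using assms by auto
  moreover have "(cmod (z 0))\<^sup>2 / nsq z + (cmod (z 1))\<^sup>2 / nsq z = 1"
    unfolding add_divide_distrib[symmetric] nsq_cmod[symmetric] using N by simp
  ultimately show ?thesis
    using N assms(2) cis_notin_nonpos_Reals annulus_nsq[OF assms(1)]
    by (auto simp: hopf_domain_def hopf_surface_def hopf_param_def norm_divide norm_mult power_divide)
qed

lemma hopf_coord_image:
  assumes "\<eta> \<in> {1, -1}"
  shows "hopf_coord \<eta> ` hopf_domain \<eta> = annulus"
  using assms hopf_coord_in_annulus hopf_param_in_domain hopf_coord_param_same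
  by (metis (no_types, lifting) image_subsetI subsetI subset_antisym rev_image_eqI)

lemma inv_into_hopf_coord:
  assumes "\<eta> \<in> {1, -1}" "z \<in> annulus"
  shows "inv_into (hopf_domain \<eta>) (hopf_coord \<eta>) z = hopf_param \<eta> z"
proof -
  have "inj_on (hopf_coord \<eta>) (hopf_domain \<eta>)"
    using hopf_param_coord[OF _ assms(1)] by (metis inj_onI)
  then show ?thesis
    using hopf_param_in_domain[OF assms(2,1)] hopf_coord_param_same[OF assms(2,1)] by (metis inv_into_f_f)
qed

lemma continuous_on_hopf_coord: "continuous_on (hopf_domain \<eta>) (hopf_coord \<eta>)"
proof (rule continuous_on_coordinatewise_then_product)
  fix k show "continuous_on (hopf_domain \<eta>) (\<lambda>w. hopf_coord \<eta> w k)"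
    by (cases "k < 2") (auto simp: hopf_coord_def hopf_domain_def intro!: continuous_intros)
qed

lemma continuous_on_hopf_param: "continuous_on annulus (hopf_param \<eta>)"
proof (rule continuous_on_coordinatewise_then_product)
  fix k show "continuous_on annulus (\<lambda>w. hopf_param \<eta> w k)"
    using annulus_nsq(1)
    by (cases "k < 2"; cases "k = 2")
       (fastforce simp: hopf_param_def intro!: continuous_intros continuous_on_compose2[OF continuous_on_cis[of UNIV id, simplified]])+
qed

lemma complex_chart_hopf:
  assumes "\<eta> \<in> {1, -1}"
  shows "complex_chart 2 (top_of_set hopf_surface) (hopf_domain \<eta>, hopf_coord \<eta>)"
  unfolding complex_chart_def fst_conv snd_conv
proof (intro conjI)
  have "open ((\<lambda>w::coords. of_real \<eta> * w 2) -` (- \<real>\<^sub>\<le>\<^sub>0))"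
    by (intro continuous_open_vimage continuous_intros) auto
  then show "openin (top_of_set hopf_surface) (hopf_domain \<eta>)"
    by (auto simp: openin_open hopf_domain_def)
  have im: "chart_image (hopf_domain \<eta>, hopf_coord \<eta>) = annulus"
    by (simp add: chart_image_def hopf_coord_image[OF assms])
  have "open {z. exp (- 2 * pi) < nsq z \<and> nsq z < exp (2 * pi)}"
    by (intro open_Collect_conj open_Collect_less continuous_intros)
  then show "openin (top_of_set (Cspace 2)) (chart_image (hopf_domain \<eta>, hopf_coord \<eta>))"
    unfolding im annulus_def openin_open by blast
  have "hopf_domain \<eta> \<subseteq> hopf_surface" by (auto simp: hopf_domain_def)
  then have "subtopology (top_of_set hopf_surface) (hopf_domain \<eta>) = top_of_set (hopf_domain \<eta>)"
    by (simp add: subtopology_subtopology inf.absorb2)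
  moreover have "homeomorphic_maps (top_of_set (hopf_domain \<eta>)) (top_of_set annulus) (hopf_coord \<eta>) (hopf_param \<eta>)"
    unfolding homeomorphic_maps_def
    using assms hopf_coord_in_annulus hopf_param_in_domain hopf_coord_param_same hopf_param_coord
      continuous_on_hopf_coord continuous_on_hopf_param
    by (simp add: continuous_map_in_subtopology image_subset_iff)
  ultimately show "homeomorphic_map (subtopology (top_of_set hopf_surface) (hopf_domain \<eta>))
      (top_of_set (chart_image (hopf_domain \<eta>, hopf_coord \<eta>))) (hopf_coord \<eta>)"
    unfolding im homeomorphic_map_maps by auto
qed

text \<open>For different charts the overlap consists of the parts N > 1 and N < 1. Passing from
  \<theta> to the principal argument of -cis \<theta> subtracts pi on the first and adds pi on the
  second, so the scaling factor is locally constant.\<close>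

lemma hopf_transition_scaling:
  assumes "c \<in> hopf_atlas" "c' \<in> hopf_atlas" "z \<in> overlap c c'"
  obtains \<rho> U where "\<rho> > 0" "open U" "z \<in> U"
    "\<And>w. w \<in> U \<inter> Cspace 2 \<Longrightarrow> transition c c' w = (\<lambda>k. of_real \<rho> * w k)"
proof -
  obtain \<eta> \<eta>' where \<eta>: "\<eta> \<in> {1, -1}" "\<eta>' \<in> {1, -1}"
    and c: "c = (hopf_domain \<eta>, hopf_coord \<eta>)" "c' = (hopf_domain \<eta>', hopf_coord \<eta>')"
    using assms by (auto simp: hopf_atlas_def)
  define V where "V = {z. exp (- 2 * pi) < nsq z \<and> nsq z < exp (2 * pi)}"
  have V: "open V" unfolding V_def
    by (intro open_Collect_conj open_Collect_less continuous_intros)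
  have VC: "w \<in> annulus \<longleftrightarrow> w \<in> V \<inter> Cspace 2" for w by (auto simp: V_def annulus_def)
  have tr: "transition c c' w =
      (\<lambda>k. of_real (exp (Arg (of_real (\<eta>' * \<eta>) * cis (ln (nsq w) / 2)) - ln (nsq w) / 2)) * w k)"
    if "w \<in> V \<inter> Cspace 2" for w
  proof -
    have w: "w \<in> annulus" using that VC by blast
    show ?thesis
      by (simp only: transition_def c comp_apply fst_conv snd_conv inv_into_hopf_coord[OF \<eta>(1) w]
          hopf_coord_param[OF w \<eta>])
  qed
  obtain x where x: "x \<in> hopf_domain \<eta>" "x \<in> hopf_domain \<eta>'" "z = hopf_coord \<eta> x"
    using assms(3) by (auto simp: overlap_def c)
  have z: "z \<in> annulus" unfolding x(3) by (rule hopf_coord_in_annulus[OF x(1)])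
  show ?thesis
  proof (cases "\<eta> = \<eta>'")
    case True
    show ?thesis
    proof (rule that[of 1 V])
      fix w assume w: "w \<in> V \<inter> Cspace 2"
      have "of_real (\<eta>' * \<eta>) * cis (ln (nsq w) / 2) = cis (ln (nsq w) / 2)" using True \<eta> by auto
      then show "transition c c' w = (\<lambda>k. of_real 1 * w k)"
        using annulus_nsq[of w] w VC by (simp add: tr Arg_cis)
    qed (use V z VC in auto)
  next
    case False
    then have e: "of_real (\<eta>' * \<eta>) * x = - x" for x :: complex using \<eta> by auto
    \<comment> \<open>The sphere N = 1 is excluded: there the last coordinate is \<eta>, on the
      branch cut of the other chart.\<close>
    have "hopf_param \<eta> z = x" using hopf_param_coord[OF x(1) \<eta>(1)] x(3) by simp
    then have "of_real \<eta>' * hopf_param \<eta> z 2 \<notin> \<real>\<^sub>\<le>\<^sub>0" using x(2) by (simp add: hopf_domain_def)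
    then have "- cis (ln (nsq z) / 2) \<notin> \<real>\<^sub>\<le>\<^sub>0"
      using e[of "cis (ln (nsq z) / 2)"] by (simp add: hopf_param_def mult.assoc)
    then have "ln (nsq z) \<noteq> 0" by (auto simp: complex_nonpos_Reals_iff)
    then have "nsq z \<noteq> 1" by auto
    \<comment> \<open>The first form serves angles in (0, pi), the second those in (-pi, 0): the
      shifted angle stays in the principal range.\<close>
    have m: "- cis x = cis (x - pi)" "- cis x = cis (x + pi)" for x
      by (auto simp: complex_eq_iff)
    show ?thesis
    proof (cases "nsq z > 1")
      case True
      show ?thesis
      proof (rule that[of "exp (- pi)" "V \<inter> {w. nsq w > 1}"])
        show "open (V \<inter> {w. nsq w > 1})"
          by (intro open_Int V open_Collect_less continuous_intros)
        fix w assume w: "w \<in> V \<inter> {w. nsq w > 1} \<inter> Cspace 2"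
        then have "ln (nsq w) > 0" "w \<in> annulus" using VC by auto
        then have "Arg (- cis (ln (nsq w) / 2)) = ln (nsq w) / 2 - pi"
          using annulus_nsq[of w] unfolding m(1) by (intro Arg_cis) auto
        then show "transition c c' w = (\<lambda>k. of_real (exp (- pi)) * w k)"
          using w by (simp add: tr e del: of_real_mult)
      qed (use z VC True in auto)
    next
      case False
      with \<open>nsq z \<noteq> 1\<close> have z1: "nsq z < 1" by simp
      show ?thesis
      proof (rule that[of "exp pi" "V \<inter> {w. nsq w < 1}"])
        show "open (V \<inter> {w. nsq w < 1})"
          by (intro open_Int V open_Collect_less continuous_intros)
        fix w assume w: "w \<in> V \<inter> {w. nsq w < 1} \<inter> Cspace 2"
        then have a: "w \<in> annulus" using VC by auto
        then have "ln (nsq w) < 0" using w annulus_nsq(1)[of w] by auto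
        then have "Arg (- cis (ln (nsq w) / 2)) = ln (nsq w) / 2 + pi"
          using annulus_nsq[OF a] unfolding m(2) by (intro Arg_cis) auto
        then show "transition c c' w = (\<lambda>k. of_real (exp pi) * w k)"
          using w by (simp add: tr e del: of_real_mult)
      qed (use z VC z1 in auto)
    qed
  qed
qed

lemma chart_image_hopf:
  "c \<in> hopf_atlas \<Longrightarrow> chart_image c = annulus"
  using hopf_coord_image[of 1] hopf_coord_image[of "- 1"] by (auto simp: hopf_atlas_def chart_image_def)

lemma overlap_subset: "c \<in> hopf_atlas \<Longrightarrow> overlap c c' \<subseteq> annulus"
  using chart_image_hopf[of c] by (auto simp: overlap_def chart_image_def)

lemma annulus_subset: "annulus \<subseteq> punctured" "annulus \<subseteq> Cspace 2"
  using annulus_nsq by (auto simp: punctured_def annulus_def)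

lemma continuous_on_coordinate_update: "continuous_on UNIV (\<lambda>w. z(j := w) :: coords)"
proof (rule continuous_on_coordinatewise_then_product)
  fix k show "continuous_on UNIV (\<lambda>w. (z(j := w)) k)"
    by (cases "k = j") (auto intro!: continuous_intros)
qed

lemma holo_map_hopf_transition:
  assumes "c \<in> hopf_atlas" "c' \<in> hopf_atlas"
  shows "holo_map 2 (overlap c c') (transition c c')"
  unfolding holo_map_def
proof (intro conjI ballI allI impI)
  show "continuous_on (overlap c c') (transition c c')"
    unfolding continuous_on_eq_continuous_within
  proof
    fix z assume z: "z \<in> overlap c c'"
    obtain \<rho> U where U: "open U" "z \<in> U"
      "\<And>w. w \<in> U \<inter> Cspace 2 \<Longrightarrow> transition c c' w = (\<lambda>k. of_real \<rho> * w k)"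
      using hopf_transition_scaling[OF assms z] by metis
    have sub: "overlap c c' \<subseteq> Cspace 2"
      using overlap_subset[OF assms(1)] annulus_subset by blast
    have "continuous_on (U \<inter> overlap c c') (\<lambda>w. (\<lambda>k. of_real \<rho> * w k) :: coords)"
      by (intro continuous_intros)
    then have "continuous_on (U \<inter> overlap c c') (transition c c')"
      using U(3) sub by (subst continuous_on_cong[OF refl]) auto
    then have "continuous (at z within (U \<inter> overlap c c')) (transition c c')"
      using z U(2) by (simp add: continuous_on_eq_continuous_within)
    then show "continuous (at z within overlap c c') (transition c c')"
      using at_within_nhd[OF U(2,1), of "U \<inter> overlap c c'" "overlap c c'"] by (simp add: continuous_within Int_ac)
  qed
next
  fix z j k assume z: "z \<in> overlap c c'" and jk: "j < (2::nat)" "k < (2::nat)"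
  obtain \<rho> U where U: "open U" "z \<in> U"
    "\<And>w. w \<in> U \<inter> Cspace 2 \<Longrightarrow> transition c c' w = (\<lambda>k. of_real \<rho> * w k)"
    using hopf_transition_scaling[OF assms z] by metis
  have zC: "z \<in> Cspace 2" using z overlap_subset[OF assms(1)] annulus_subset by blast
  let ?V = "(\<lambda>w. z(j := w)) -` U"
  have V: "open ?V"
    using continuous_on_coordinate_update[of z j] U(1) by (simp add: continuous_on_open_vimage)
  have "((\<lambda>w. of_real \<rho> * (z(j := w)) k) has_field_derivative (if k = j then of_real \<rho> else 0)) (at (z j))"
    by (cases "k = j") (auto intro!: derivative_eq_intros)
  then have "((\<lambda>w. transition c c' (z(j := w)) k) has_field_derivative (if k = j then of_real \<rho> else 0)) (at (z j))"
  proof (rule has_field_derivative_transform_within_open[OF _ V])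
    show "z j \<in> ?V" using U(2) by simp
    fix w assume "w \<in> ?V"
    moreover have "z(j := w) \<in> Cspace 2" using zC jk by (simp add: Cspace_def)
    ultimately show "of_real \<rho> * (z(j := w)) k = transition c c' (z(j := w)) k"
      using U(3)[of "z(j := w)"] by simp
  qed
  then show "(\<lambda>w. transition c c' (z(j := w)) k) field_differentiable at (z j)"
    by (auto simp: field_differentiable_def)
qed

lemma compact_complex_manifold_hopf:
  "compact_complex_manifold 2 (top_of_set hopf_surface) hopf_atlas"
  unfolding compact_complex_manifold_def
proof (intro conjI ballI)
  show "compact_space (top_of_set hopf_surface)"
    using compact_hopf_surface by (simp add: compact_space_subtopology)
  show "Hausdorff_space (top_of_set hopf_surface)"
    by (rule Hausdorff_space_subtopology)
       (metis Hausdorff_space_euclidean Hausdorff_space_product_topology euclidean_product_topology)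
  have "w \<in> hopf_domain 1 \<union> hopf_domain (- 1)" if "w \<in> hopf_surface" for w
  proof -
    have "w 2 \<noteq> 0" using that by (auto simp: hopf_surface_def)
    then show ?thesis using that by (auto simp: hopf_domain_def complex_nonpos_Reals_iff complex_eq_iff)
  qed
  then show "(\<Union>c\<in>hopf_atlas. fst c) = topspace (top_of_set hopf_surface)"
    by (auto simp: hopf_atlas_def hopf_domain_def)
qed (auto simp: hopf_atlas_def complex_chart_hopf intro!: holo_map_hopf_transition)

section \<open>Descent of the metrics to the surface\<close>

lemma rcoord_scale: "rcoord k (\<lambda>m. of_real r * z m) = r * rcoord k z"
  by (simp add: rcoord_def)

lemma jcoord_scale: "jcoord k (\<lambda>m. of_real r * z m) = r * jcoord k z"
  by (simp add: jcoord_def Jc_def rcoord_scale)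

text \<open>The components are homogeneous of degree -2, so positive dilations are isometries.
  Transitions are locally such dilations, hence the same matrix field in both charts defines a
  metric on the surface.\<close>

lemma hopf_metric_scale:
  assumes "r > 0"
  shows "r\<^sup>2 * hopf_metric a b (\<lambda>m. of_real r * z m) i j = hopf_metric a b z i j"
proof -
  have "nsq (\<lambda>m. of_real r * z m) = r\<^sup>2 * nsq z"
    by (simp add: nsq_def rcoord_scale power_mult_distrib sum_distrib_left)
  then have "inverse (nsq (\<lambda>m. of_real r * z m)) = (inverse r)\<^sup>2 * inverse (nsq z)"
    by (simp add: power_inverse)
  moreover have "r * inverse r = 1" using assms by simp
  ultimately show ?thesis
    unfolding hopf_metric_def rcoord_scale jcoord_scale by algebra
qed

lemma move_in_Cspace: "z \<in> Cspace n \<Longrightarrow> i < 2 * n \<Longrightarrow> move i r z \<in> Cspace n"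
  by (auto simp: Cspace_def move_def)

lemma pd_hopf_transition:
  assumes "open U" "z \<in> U \<inter> Cspace 2" "i < 4"
    "\<And>w. w \<in> U \<inter> Cspace 2 \<Longrightarrow> transition c c' w = (\<lambda>k. of_real r * w k)"
  shows "pd i (\<lambda>w. rcoord k (transition c c' w)) z = r * kd k i"
proof (rule pd_eqI)
  \<comment> \<open>The formula for the transition is known only inside \<open>Cspace 2\<close>;
    moving in one of the first four real directions does not leave that space.\<close>
  have "\<forall>\<^sub>F s in nhds 0. r * rcoord k (move i s z) = rcoord k (transition c c' (move i s z))"
    using eventually_move_in[OF assms(1), of z i] assms(2)
    by (auto elim!: eventually_mono simp: assms(3,4) move_in_Cspace rcoord_scale)
  moreover have "((\<lambda>s. r * rcoord k (move i s z)) has_real_derivative r * kd k i) (at 0)"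
    by (auto simp: kd_def intro!: derivative_eq_intros)
  ultimately show "((\<lambda>s. rcoord k (transition c c' (move i s z))) has_real_derivative r * kd k i) (at 0)"
    by (rule DERIV_cong_ev[OF refl _ refl, THEN iffD1])
qed

lemma smooth_family_hopf_metric:
  assumes "T > 0" "c \<in> hopf_atlas"
  shows "smooth_family 2 T (chart_image c) (\<lambda>s z. hopf_metric (p + q * s) b z i j)"
  using assms annulus_subset
  by (intro smooth_family_rational_family rational_family_hopf_metric) (simp_all add: chart_image_hopf)

lemma hermitian_metric_hopf:
  assumes "a > 0" "b > 0"
  shows "hermitian_metric 2 hopf_atlas (\<lambda>_. hopf_metric a b)"
  unfolding hermitian_metric_def
proof (intro conjI ballI allI impI)
  fix c z assume "c \<in> hopf_atlas" "z \<in> chart_image c"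
  then show "hermitian_form 2 (hopf_metric a b z)"
    using assms annulus_subset by (intro hermitian_form_hopf_metric) (auto simp: chart_image_hopf)
next
  fix c i j assume "c \<in> hopf_atlas"
  \<comment> \<open>Slice at time 0 of a constant family: T = 1 and q = 0.\<close>
  then show "smooth_fun 2 (chart_image c) (\<lambda>z. hopf_metric a b z i j)"
    using smooth_fun_slice[OF smooth_family_hopf_metric[of 1 c a 0 b i j], of 0] by simp
next
  fix c c' z and i j :: nat
  assume c: "c \<in> hopf_atlas" "c' \<in> hopf_atlas" "z \<in> overlap c c'" and ij: "i < 2*2" "j < (2*2::nat)"
  obtain r U where r: "r > 0" and U: "open U" "z \<in> U"
    "\<And>w. w \<in> U \<inter> Cspace 2 \<Longrightarrow> transition c c' w = (\<lambda>k. of_real r * w k)"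
    using hopf_transition_scaling[OF c] by metis
  have z: "z \<in> U \<inter> Cspace 2"
    using U(2) c overlap_subset annulus_subset by blast
  have "(\<Sum>k<4. \<Sum>l<4. (r * kd k i) * (r * kd l j) * hopf_metric a b (\<lambda>m. of_real r * z m) k l) =
      (\<Sum>k<4. kd k i * (\<Sum>l<4. kd l j * (r\<^sup>2 * hopf_metric a b (\<lambda>m. of_real r * z m) k l)))"
    by (simp add: sum_distrib_left power2_eq_square mult_ac)
  also have "\<dots> = hopf_metric a b z i j"
    using ij by (simp add: sum_kd hopf_metric_scale[OF r])
  finally show "hopf_metric a b z i j =
          (\<Sum>k<2*2. \<Sum>l<2*2.
             pd i (\<lambda>w. rcoord k (transition c c' w)) z *
             pd j (\<lambda>w. rcoord l (transition c c' w)) z *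
             hopf_metric a b (transition c c' z) k l)"
    using ij pd_hopf_transition[OF U(1) z _ U(3)] U(3)[OF z] by simp
qed

section \<open>The flow and the flatness criterion\<close>

lemma fundamental_form_hopf_affine:
  "fundamental_form 2 (hopf_metric (p + q * s) b) z X Y =
    fundamental_form 2 (hopf_metric p b) z X Y + s * (q * fundamental_form 2 (hopf_metric 1 0) z X Y)"
proof -
  have "hopf_metric (p + q * s) b z i j = hopf_metric p b z i j + s * (q * hopf_metric 1 0 z i j)" for i j
    unfolding hopf_metric_def by algebra
  then show ?thesis
    by (simp add: fundamental_form_def bil_def distrib_right sum.distrib sum_distrib_left mult.assoc)
qed

text \<open>The Chern-Ricci form 4 \<omega>_{1,0} forces a to decrease at rate 4; p \<ge> 4T keeps
  it positive at all times before T.\<close>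

lemma chern_ricci_flow_hopf:
  assumes "T > 0" "p - 4 * T \<ge> 0" "b > 0"
  shows "chern_ricci_flow 2 hopf_atlas T (\<lambda>s _. hopf_metric (p + (- 4) * s) b)"
  unfolding chern_ricci_flow_def
proof (intro conjI ballI allI impI)
  fix s assume s: "s \<in> {0..<T}"
  then have a: "p + (- 4) * s > 0" using assms(2) by auto
  then show "hermitian_metric 2 hopf_atlas (\<lambda>_. hopf_metric (p + (- 4) * s) b)"
    using assms by (intro hermitian_metric_hopf)
  fix c z X Y assume "c \<in> hopf_atlas" "z \<in> chart_image c"
  then have "z \<in> punctured" using annulus_subset by (auto simp: chart_image_hopf)
  from ricci_form_hopf[OF this a assms(3), of 0] have ricci:
    "- ricci_form 2 1 (hopf_metric (p + (- 4) * s) b) z X Y =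
      of_real ((- 4) * fundamental_form 2 (hopf_metric 1 0) z X Y)" by simp
  have "((\<lambda>r. fundamental_form 2 (hopf_metric (p + (- 4) * r) b) z X Y) has_real_derivative
      ((- 4) * fundamental_form 2 (hopf_metric 1 0) z X Y)) (at s within {0..<T})"
    unfolding fundamental_form_hopf_affine by (auto intro!: derivative_eq_intros)
  from has_vector_derivative_of_real[OF this]
  show "((\<lambda>r. complex_of_real (fundamental_form 2 (hopf_metric (p + (- 4) * r) b) z X Y))
      has_vector_derivative - ricci_form 2 1 (hopf_metric (p + (- 4) * s) b) z X Y) (at s within {0..<T})"
    unfolding ricci .
qed (use assms in \<open>intro smooth_family_hopf_metric\<close>)

text \<open>The form \<omega>_{1,0} is nonzero and invariant under J, so flatness means that the
  scalar coefficient 1 + \<tau> b/a vanishes.\<close>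

lemma gauduchon_ricci_flat_hopf_iff:
  assumes "a > 0" "b > 0"
  shows "gauduchon_ricci_flat 2 hopf_atlas t (\<lambda>_. hopf_metric a b) \<longleftrightarrow> 2 * a = (1 - t) * b"
proof -
  define \<tau> where "\<tau> = (t - 1) / 2"
  have t: "t = 1 + 2 * \<tau>" by (simp add: \<tau>_def field_simps)
  have iff: "1 + \<tau> * b / a = 0 \<longleftrightarrow> 2 * a = (1 - t) * b"
    using assms by (auto simp: \<tau>_def field_simps)
  note R = ricci_form_hopf[OF _ assms, of _ \<tau>, folded t]
  show ?thesis
  proof
    assume flat: "gauduchon_ricci_flat 2 hopf_atlas t (\<lambda>_. hopf_metric a b)"
    \<comment> \<open>At (1, 0) the complex line through z is the first coordinate axis, so the test
      vectors \<open>ev 2\<close> and \<open>ev 3\<close> are transversal and \<omega>_{1,0} is 1 on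
      them.\<close>
    define z :: coords where "z = (\<lambda>k. if k = 0 then 1 else 0)"
    have N: "nsq z = 1" by (simp add: nsq_cmod z_def)
    have "z \<in> annulus" by (simp add: annulus_def N Cspace_def) (simp add: z_def)
    then have z: "z \<in> punctured" "\<And>c. c \<in> hopf_atlas \<Longrightarrow> z \<in> chart_image c"
      using annulus_subset by (auto simp: chart_image_hopf)
    have x: "rcoord 2 z = 0" "rcoord 3 z = 0" by (simp_all add: rcoord_def z_def)
    have f: "fundamental_form 2 (hopf_metric 1 0) z (ev 2) (ev 3) = 1"
      by (simp add: fundamental_form_hopf_ev N x) (simp add: Jc_def ev_def)
    \<comment> \<open>Invariance under J on this pair: the two halves of the (1,1)-part are equal
      and cannot cancel.\<close>
    have "Jc (ev 2) = ev 3" "Jc (ev 3) = (\<lambda>k. - ev 2 k)"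
      by (simp_all add: Jc_ev flipJ_def sgnJ_def)
    then have "fundamental_form 2 (hopf_metric 1 0) z (Jc (ev 2)) (Jc (ev 3)) =
        - fundamental_form 2 (hopf_metric 1 0) z (ev 3) (ev 2)"
      by (simp only: fundamental_form_def bil_def) (simp add: sum_negf)
    then have f': "fundamental_form 2 (hopf_metric 1 0) z (Jc (ev 2)) (Jc (ev 3)) = 1"
      by (simp add: fundamental_form_hopf_ev N x) (simp add: Jc_def ev_def)
    obtain c where "c \<in> hopf_atlas" by (auto simp: hopf_atlas_def)
    with flat z have "ricci_form_11 2 t (hopf_metric a b) z (ev 2) (ev 3) = 0"
      unfolding gauduchon_ricci_flat_def by blast
    then have "1 + \<tau> * b / a = 0"
      unfolding ricci_form_11_def R[OF z(1)] f f' by (simp flip: of_real_add)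
    then show "2 * a = (1 - t) * b" using iff by simp
  next
    assume "2 * a = (1 - t) * b"
    then have 0: "1 + \<tau> * b / a = 0" using iff by simp
    have "z \<in> punctured" if "c \<in> hopf_atlas" "z \<in> chart_image c" for c z
      using that annulus_subset by (auto simp: chart_image_hopf)
    then show "gauduchon_ricci_flat 2 hopf_atlas t (\<lambda>_. hopf_metric a b)"
      unfolding gauduchon_ricci_flat_def ricci_form_11_def by (simp add: R 0)
  qed
qed

theorem corollary1p1:
  fixes t :: real
  assumes "t < 1"
  shows "\<exists>(n::nat) (X :: (nat \<Rightarrow> complex) topology) A T g.
           compact_complex_manifold n X A \<and> T > 0 \<and>
           chern_ricci_flow n A T g \<and>
           gauduchon_ricci_flat n A t (g 0) \<and>
           (\<exists>s\<in>{0<..<T}. \<not> gauduchon_ricci_flat n A t (g s))"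
proof -
  \<comment> \<open>With b = 2 the flatness condition 2a = (1 - t) b reads a = 1 - t, the initial
    value below. At rate 4 it would reach 0 exactly at time T, where the metric degenerates.\<close>
  define T where "T = (1 - t) / 4"
  define g where "g = (\<lambda>s. \<lambda>_ :: coords chart. hopf_metric ((1 - t) + (- 4) * s) 2)"
  have T: "T > 0" "(1 - t) - 4 * T \<ge> 0" using assms by (auto simp: T_def)
  have "chern_ricci_flow 2 hopf_atlas T g"
    unfolding g_def by (rule chern_ricci_flow_hopf[OF T]) simp
  moreover have "gauduchon_ricci_flat 2 hopf_atlas t (g 0)"
    using assms by (simp add: g_def gauduchon_ricci_flat_hopf_iff)
  \<comment> \<open>At half the lifespan a has dropped to (1 - t)/2 while b is still 2, so the two
    sides of the criterion differ by a factor of 2.\<close>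
  moreover have "\<not> gauduchon_ricci_flat 2 hopf_atlas t (g (T / 2))"
    unfolding g_def by (subst gauduchon_ricci_flat_hopf_iff) (use assms in \<open>auto simp: T_def field_simps\<close>)
  moreover have "T / 2 \<in> {0<..<T}" using T by simp
  ultimately show ?thesis
    using compact_complex_manifold_hopf T(1) by blast
qed

end
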